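(* Let $n\ge 1$, $0<s<1$, $1<q<2$, and let $\Omega\subset\mathbb{R}^n$ be a bounded open set with Wiener regular boundary for the $s$-fractional Laplacian. Let \[ \Lambda_q:=\inf_{\phi\in C^\infty_0(\Omega)}\Bigl\{\iint_{\mathbb{R}^n\times\mathbb{R}^n}\frac{|\phi(x)-\phi(y)|^2}{|x-y|^{n+2s}}\,dx\,dy \;:\; \|\phi\|_{L^q(\Omega)}=1\Bigr\}. \] Then there are no sequences $\lambda_i\in(0,\infty)\setminus\{\Lambda_q\}$ and $v_i\in\mathcal{D}^{s,2}_0(\Omega)$ such that $\|v_i\|_{L^q(\Omega)}=1$, $(-\Delta)^s v_i=\lambda_i|v_i|^{q-2}v_i$ weakly in $\Omega$ for every $i$, and $\lim_{i\to\infty}\lambda_i=\Lambda_q$.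
   Context: $\mathcal{D}^{s,2}_0(\Omega)$ is the completion of $C^\infty_0(\Omega)$ with respect to the seminorm $[\phi]_{H^s(\mathbb{R}^n)}=\bigl(\iint_{\mathbb{R}^n\times\mathbb{R}^n}\frac{|\phi(x)-\phi(y)|^2}{|x-y|^{n+2s}}dxdy\bigr)^{1/2}$. For $F$ in the dual of $\mathcal{D}^{s,2}_0(\Omega)$ and $g\in V^{s,2}(\Omega|\mathbb{R}^n)$, a function $u$ with $u-g\in\mathcal{D}^{s,2}_0(\Omega)$ is a weak solution of $(-\Delta)^s u=F$ in $\Omega$, $u=g$ in $\mathbb{R}^n\setminus\Omega$, if $\iint_{\mathbb{R}^n\times\mathbb{R}^n}\frac{(u(x)-u(y))(\phi(x)-\phi(y))}{|x-y|^{n+2s}}dxdy=\langle F,\phi\rangle$ for all $\phi\in\mathcal{D}^{s,2}_0(\Omega)$ (for $v_i$ above, $g=0$ and $\langle F,\phi\rangle=\int_\Omega\lambda_i|v_i|^{q-2}v_i\phi$). Here $V^{s,2}(\Omega|\mathbb{R}^n)$ is the space of measurable $u:\mathbb{R}^n\to\mathbb{R}$ with $u|_\Omega\in L^2(\Omega)$ and $\iint_{\Omega\times\mathbb{R}^n}\frac{|u(x)-u(y)|^2}{|x-y|^{n+2s}}dxdy<\infty$. A point $\xi_0\in\partial\Omega$ is regular for the $s$-fractional Laplacian if for every $f\in L^\infty(\Omega)$, $g\in C(\mathbb{R}^n)\cap V^{s,2}(\Omega|\mathbb{R}^n)$ and every $u\in V^{s,2}(\Omega|\mathbb{R}^n)$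 that is a weak solution of $(-\Delta)^s u=f$ in $\Omega$, $u=g$ in $\mathbb{R}^n\setminus\Omega$, one has $\lim_{\xi\to\xi_0}u(\xi)=g(\xi_0)$; $\Omega$ has Wiener regular boundary for the $s$-fractional Laplacian if every point of $\partial\Omega$ is regular. *)

theory Defs
  imports "HOL-Analysis.Analysis"
begin

text \<open>Functions on R^n are modelled as real-valued functions on an arbitrary
  Euclidean space 'a, with n = DIM('a) >= 1.\<close>

fun iter_dderiv :: "'a::euclidean_space list \<Rightarrow> ('a \<Rightarrow> real) \<Rightarrow> ('a \<Rightarrow> real)" where
  "iter_dderiv [] f = f"
| "iter_dderiv (v # vs) f = (\<lambda>x. frechet_derivative (iter_dderiv vs f) (at x) v)"

definition smooth_fun :: "('a::euclidean_space \<Rightarrow> real) \<Rightarrow> bool" where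
  "smooth_fun f \<longleftrightarrow> (\<forall>vs. (\<forall>x. iter_dderiv vs f differentiable (at x)))"

definition tsupp :: "('a::euclidean_space \<Rightarrow> real) \<Rightarrow> 'a set" where
  "tsupp f = closure {x. f x \<noteq> 0}"

definition test_funs :: "'a::euclidean_space set \<Rightarrow> ('a \<Rightarrow> real) set" where
  "test_funs \<Omega> = {\<phi>. smooth_fun \<phi> \<and> compact (tsupp \<phi>) \<and> tsupp \<phi> \<subseteq> \<Omega>}"

definition frac_kernel :: "real \<Rightarrow> 'a::euclidean_space \<Rightarrow> 'a \<Rightarrow> real" where
  "frac_kernel s x y = 1 / (dist x y powr (real DIM('a) + 2 * s))"

definition gagliardo_sq :: "real \<Rightarrow> ('a::euclidean_space \<Rightarrow> real) \<Rightarrow> ennreal" where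
  "gagliardo_sq s u =
     (\<integral>\<^sup>+ p. ennreal ((u (fst p) - u (snd p))\<^sup>2 * frac_kernel s (fst p) (snd p))
        \<partial>(lebesgue \<Otimes>\<^sub>M lebesgue))"

definition Lq_norm :: "real \<Rightarrow> 'a::euclidean_space set \<Rightarrow> ('a \<Rightarrow> real) \<Rightarrow> real" where
  "Lq_norm q \<Omega> u = (enn2real (\<integral>\<^sup>+ x\<in>\<Omega>. ennreal (\<bar>u x\<bar> powr q) \<partial>lebesgue)) powr (1 / q)"

text \<open>D^{s,2}_0(Omega): completion of C^infinity_0(Omega) w.r.t. the Gagliardo seminorm,
  realised concretely as the measurable functions on R^n approximable by test functions
  in the Gagliardo seminorm and (for identification of the limit) in L^2(R^n).\<close>
definition D_s2_0 :: "real \<Rightarrow> 'a::euclidean_space set \<Rightarrow> ('a \<Rightarrow> real) set" where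
  "D_s2_0 s \<Omega> = {u. u \<in> borel_measurable lebesgue \<and>
      (\<exists>\<phi>::nat \<Rightarrow> 'a \<Rightarrow> real. (\<forall>k. \<phi> k \<in> test_funs \<Omega>) \<and>
          (\<lambda>k. gagliardo_sq s (\<lambda>x. \<phi> k x - u x)) \<longlonglongrightarrow> 0 \<and>
          (\<lambda>k. \<integral>\<^sup>+ x. ennreal ((\<phi> k x - u x)\<^sup>2) \<partial>lebesgue) \<longlonglongrightarrow> 0)}"

definition V_s2 :: "real \<Rightarrow> 'a::euclidean_space set \<Rightarrow> ('a \<Rightarrow> real) set" where
  "V_s2 s \<Omega> = {u. u \<in> borel_measurable lebesgue \<and>
      (\<integral>\<^sup>+ x\<in>\<Omega>. ennreal ((u x)\<^sup>2) \<partial>lebesgue) < \<infinity> \<and>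
      (\<integral>\<^sup>+ p\<in>\<Omega> \<times> UNIV. ennreal ((u (fst p) - u (snd p))\<^sup>2 * frac_kernel s (fst p) (snd p))
          \<partial>(lebesgue \<Otimes>\<^sub>M lebesgue)) < \<infinity>}"

definition frac_form :: "real \<Rightarrow> ('a::euclidean_space \<Rightarrow> real) \<Rightarrow> ('a \<Rightarrow> real) \<Rightarrow> real" where
  "frac_form s u \<phi> =
     (\<integral> p. (u (fst p) - u (snd p)) * (\<phi> (fst p) - \<phi> (snd p)) * frac_kernel s (fst p) (snd p)
        \<partial>(lebesgue \<Otimes>\<^sub>M lebesgue))"

text \<open>Weak solution of (-Delta)^s u = F in Omega, u = g in R^n \ Omega,
  with F a functional on D^{s,2}_0(Omega).\<close>
definition weak_solution ::
  "real \<Rightarrow> 'a::euclidean_space set \<Rightarrow> (('a \<Rightarrow> real) \<Rightarrow> real) \<Rightarrow> ('a \<Rightarrow> real) \<Rightarrow> ('a \<Rightarrow> real) \<Rightarrow> bool" where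
  "weak_solution s \<Omega> F g u \<longleftrightarrow>
     (\<lambda>x. u x - g x) \<in> D_s2_0 s \<Omega> \<and> (\<forall>\<phi>\<in>D_s2_0 s \<Omega>. frac_form s u \<phi> = F \<phi>)"

definition Linf_on :: "'a::euclidean_space set \<Rightarrow> ('a \<Rightarrow> real) \<Rightarrow> bool" where
  "Linf_on \<Omega> f \<longleftrightarrow> f \<in> borel_measurable lebesgue \<and>
     (\<exists>C. AE x in lebesgue. x \<in> \<Omega> \<longrightarrow> \<bar>f x\<bar> \<le> C)"

text \<open>Limit of a (Lebesgue a.e. defined) function at a point, in the essential sense,
  i.e. independent of the chosen representative.\<close>
definition ess_tendsto_at :: "('a::euclidean_space \<Rightarrow> real) \<Rightarrow> real \<Rightarrow> 'a \<Rightarrow> bool" where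
  "ess_tendsto_at u l \<xi>0 \<longleftrightarrow>
     (\<forall>\<epsilon>>0. \<exists>\<delta>>0. AE \<xi> in lebesgue. \<xi> \<in> ball \<xi>0 \<delta> \<longrightarrow> \<bar>u \<xi> - l\<bar> < \<epsilon>)"

definition regular_point :: "real \<Rightarrow> 'a::euclidean_space set \<Rightarrow> 'a \<Rightarrow> bool" where
  "regular_point s \<Omega> \<xi>0 \<longleftrightarrow>
     (\<forall>f g u. Linf_on \<Omega> f \<longrightarrow> continuous_on UNIV g \<longrightarrow> g \<in> V_s2 s \<Omega> \<longrightarrow>
        u \<in> V_s2 s \<Omega> \<longrightarrow>
        weak_solution s \<Omega> (\<lambda>\<phi>. \<integral>x\<in>\<Omega>. f x * \<phi> x \<partial>lebesgue) g u \<longrightarrow>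
        ess_tendsto_at u (g \<xi>0) \<xi>0)"

definition wiener_regular :: "real \<Rightarrow> 'a::euclidean_space set \<Rightarrow> bool" where
  "wiener_regular s \<Omega> \<longleftrightarrow> (\<forall>\<xi>0\<in>frontier \<Omega>. regular_point s \<Omega> \<xi>0)"

definition Lambda_q :: "real \<Rightarrow> real \<Rightarrow> 'a::euclidean_space set \<Rightarrow> real" where
  "Lambda_q s q \<Omega> =
     enn2real (INF \<phi>\<in>{\<phi>\<in>test_funs \<Omega>. Lq_norm q \<Omega> \<phi> = 1}. gagliardo_sq s \<phi>)"

end

theory Submission
  imports Defs
begin

text \<open>Write \<open>E(u)\<close> for the squared Gagliardo seminorm and \<open>v = v\<^sup>+ - v\<^sup>-\<close> for a
  normalised solution with parameter \<open>\<lambda>\<close>, so that \<open>E(v) = \<lambda>\<close>. Nonlocality replaces compactness and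
  boundary regularity. On the bounded set \<open>\<Omega>\<close> the kernel has a lower bound \<open>\<kappa> > 0\<close>, and comparing \<open>v\<close>
  with \<open>|v|\<close> gives \<open>\<Lambda> + \<kappa> \<integral>v\<^sup>+ \<integral>v\<^sup>- \<le> \<lambda>\<close>. As \<open>\<integral>|v|\<close> is bounded below, for \<open>\<lambda>\<close> close to \<open>\<Lambda>\<close> one of the
  masses, say \<open>\<integral>v\<^sup>-\<close>, is small while the other one is not.

  Testing the equation with \<open>w = v\<^sup>-\<close> gives \<open>E(w) + \<kappa> \<integral>v\<^sup>+ \<integral>w \<le> \<lambda> \<integral>w\<^sup>q\<close>. Since \<open>1 < q < 2\<close>, one has
  \<open>\<lambda> w\<^sup>q \<le> c w + K ((w - \<tau>)\<^sup>+)\<^sup>2\<close> pointwise with \<open>c \<le> \<kappa> \<integral>v\<^sup>+\<close>, hence \<open>E(w) \<le> K \<integral>((w - \<tau>)\<^sup>+)\<^sup>2\<close>. The set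
  \<open>w > \<tau>\<close> has small measure, so by a Poincare inequality for functions with small support the right
  hand side is at most \<open>E(w) / 2\<close>. Therefore \<open>w = 0\<close> and \<open>v\<close> has a sign.

  A nonnegative solution satisfies \<open>\<lambda> \<le> \<Lambda>\<close>: test with \<open>\<psi>\<^sup>2 / (v + \<epsilon>)\<close> for a test function \<open>\<psi>\<close> of
  unit norm, use the Picone identity and let \<open>\<epsilon>\<close> tend to 0. Its remainder forces \<open>v > 0\<close> where \<open>\<psi>\<close> does
  not vanish, and \<open>\<lambda> \<integral>v\<^bsup>q-2\<^esup> \<psi>\<^sup>2 \<le> E(\<psi>)\<close>, where the integral is at least 1 by weighted AM-GM.\<close>

section \<open>Smooth functions and test functions\<close>

lemma iter_dderiv_append: "iter_dderiv vs (iter_dderiv ws f) = iter_dderiv (vs @ ws) f"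
  by (induction vs) auto

text \<open>A class of differentiable functions closed under directional derivatives contains all
  iterated derivatives of its members, by induction on the list of directions. This replaces
  explicit formulas for higher derivatives.\<close>

lemma smooth_fun_coinduct:
  assumes "f \<in> S"
    and "\<And>f x. f \<in> S \<Longrightarrow> f differentiable (at x)"
    and "\<And>f v. f \<in> S \<Longrightarrow> (\<lambda>x. frechet_derivative f (at x) v) \<in> S"
  shows "smooth_fun f"
proof -
  have "iter_dderiv vs f \<in> S" for vs
    by (induction vs) (use assms in auto)
  then show ?thesis
    using assms(2) by (auto simp: smooth_fun_def)
qed

lemma smooth_fun_differentiable: "smooth_fun f \<Longrightarrow> f differentiable (at x)"
  unfolding smooth_fun_def by (metis iter_dderiv.simps(1))

lemma smooth_fun_has_derivative:
  "smooth_fun f \<Longrightarrow> (f has_derivative frechet_derivative f (at x)) (at x)"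
  using smooth_fun_differentiable frechet_derivative_works by blast

lemma smooth_fun_frechet_derivative:
  assumes "smooth_fun f"
  shows "smooth_fun (\<lambda>x. frechet_derivative f (at x) v)"
  using assms iter_dderiv_append[of _ "[v]" f] by (auto simp: smooth_fun_def)

lemma smooth_fun_continuous_on: "smooth_fun f \<Longrightarrow> continuous_on A f"
  by (meson continuous_at_imp_continuous_on differentiable_imp_continuous_within
      smooth_fun_differentiable)

lemma smooth_fun_const: "smooth_fun (\<lambda>x::'a::euclidean_space. c)"
  by (rule smooth_fun_coinduct[of _ "range (\<lambda>c x. c)"]) (auto simp: frechet_derivative_const)

text \<open>All real exponents \<open>r\<close> are included because differentiating a power lowers
  its exponent by one, and \<open>base\<close> supplies the derivative of \<open>u\<close> in the
  chain rule. For smooth positive \<open>u\<close> the algebra is therefore closed under directional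
  derivatives.\<close>

inductive_set smooth_powr_alg :: "('a::euclidean_space \<Rightarrow> real) \<Rightarrow> ('a \<Rightarrow> real) set" for u where
  base: "smooth_fun f \<Longrightarrow> f \<in> smooth_powr_alg u"
| powr: "(\<lambda>x. u x powr r) \<in> smooth_powr_alg u"
| add: "f \<in> smooth_powr_alg u \<Longrightarrow> g \<in> smooth_powr_alg u \<Longrightarrow> (\<lambda>x. f x + g x) \<in> smooth_powr_alg u"
| mult: "f \<in> smooth_powr_alg u \<Longrightarrow> g \<in> smooth_powr_alg u \<Longrightarrow> (\<lambda>x. f x * g x) \<in> smooth_powr_alg u"

lemma smooth_powr_alg_has_derivative:
  assumes "smooth_fun u" "\<And>x. 0 < u x" "f \<in> smooth_powr_alg u"
  shows "\<exists>D. (\<forall>x. (f has_derivative D x) (at x)) \<and> (\<forall>v. (\<lambda>x. D x v) \<in> smooth_powr_alg u)"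
  using assms(3)
proof induction
  case (base f)
  then show ?case
    by (intro exI[of _ "\<lambda>x. frechet_derivative f (at x)"])
      (auto intro: smooth_fun_has_derivative smooth_powr_alg.base smooth_fun_frechet_derivative)
next
  case (powr r)
  have "((\<lambda>x. u x powr r) has_derivative
      (\<lambda>v. r * u x powr (r - 1) * frechet_derivative u (at x) v)) (at x)" for x
    by (rule derivative_eq_intros smooth_fun_has_derivative[OF assms(1)] assms(2) | simp)+
      (use assms(2)[of x] in \<open>auto simp: powr_diff field_simps\<close>)
  moreover have "(\<lambda>x. r * u x powr (r - 1) * frechet_derivative u (at x) v) \<in> smooth_powr_alg u" for v
    by (intro smooth_powr_alg.intros smooth_fun_const smooth_fun_frechet_derivative assms)
  ultimately show ?case
    by (intro exI[of _ "\<lambda>x v. r * u x powr (r - 1) * frechet_derivative u (at x) v"]) auto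
next
  case (add f g)
  then obtain D E where *: "\<And>x. (f has_derivative D x) (at x)" "\<And>v. (\<lambda>x. D x v) \<in> smooth_powr_alg u"
     "\<And>x. (g has_derivative E x) (at x)" "\<And>v. (\<lambda>x. E x v) \<in> smooth_powr_alg u"
    by blast
  then show ?case
    by (intro exI[of _ "\<lambda>x v. D x v + E x v"])
      (auto intro!: has_derivative_add smooth_powr_alg.add)
next
  case (mult f g)
  then obtain D E where *: "\<And>x. (f has_derivative D x) (at x)" "\<And>v. (\<lambda>x. D x v) \<in> smooth_powr_alg u"
     "\<And>x. (g has_derivative E x) (at x)" "\<And>v. (\<lambda>x. E x v) \<in> smooth_powr_alg u"
    by blast
  then show ?case
    by (intro exI[of _ "\<lambda>x v. f x * E x v + D x v * g x"] conjI allI has_derivative_mult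
        smooth_powr_alg.add smooth_powr_alg.mult mult.hyps) auto
qed

lemma smooth_powr_alg_smooth:
  assumes "smooth_fun u" "\<And>x. 0 < u x" "f \<in> smooth_powr_alg u"
  shows "smooth_fun f"
proof (rule smooth_fun_coinduct[OF assms(3)])
  fix f assume "f \<in> smooth_powr_alg u"
  then obtain D where D: "\<And>x. (f has_derivative D x) (at x)" "\<And>v. (\<lambda>x. D x v) \<in> smooth_powr_alg u"
    using smooth_powr_alg_has_derivative[OF assms(1,2)] by blast
  then show "f differentiable (at x)" for x
    by (auto simp: differentiable_def)
  have "frechet_derivative f (at x) = D x" for x
    using D(1) frechet_derivative_at by metis
  with D(2) show "(\<lambda>x. frechet_derivative f (at x) v) \<in> smooth_powr_alg u" for v
    by simp
qed

lemma smooth_fun_powr: "smooth_fun u \<Longrightarrow> (\<And>x. 0 < u x) \<Longrightarrow> smooth_fun (\<lambda>x. u x powr r)"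
  by (erule smooth_powr_alg_smooth) (auto intro: smooth_powr_alg.powr)

text \<open>The algebra generated over the constant function 1 already contains sums and products of
  arbitrary smooth functions.\<close>

lemma smooth_fun_add: "smooth_fun f \<Longrightarrow> smooth_fun g \<Longrightarrow> smooth_fun (\<lambda>x. f x + g x)"
  by (rule smooth_powr_alg_smooth[OF smooth_fun_const[of 1]]) (auto intro: smooth_powr_alg.intros)

lemma smooth_fun_mult: "smooth_fun f \<Longrightarrow> smooth_fun g \<Longrightarrow> smooth_fun (\<lambda>x. f x * g x)"
  by (rule smooth_powr_alg_smooth[OF smooth_fun_const[of 1]]) (auto intro: smooth_powr_alg.intros)

lemma smooth_fun_diff: "smooth_fun f \<Longrightarrow> smooth_fun g \<Longrightarrow> smooth_fun (\<lambda>x. f x - g x)"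
  using smooth_fun_add[OF _ smooth_fun_mult[OF smooth_fun_const[of "-1"]], of f g] by simp

lemma smooth_fun_sqrt:
  assumes "smooth_fun u" "\<And>x. 0 < u x"
  shows "smooth_fun (\<lambda>x. sqrt (u x))"
  using smooth_fun_powr[OF assms, of "1/2"] assms(2) by (simp add: powr_half_sqrt less_imp_le)

lemma smooth_fun_inverse:
  assumes "smooth_fun u" "\<And>x. 0 < u x"
  shows "smooth_fun (\<lambda>x. inverse (u x))"
  using smooth_fun_powr[OF assms, of "-1"] assms(2) by (simp add: powr_minus less_imp_le)

text \<open>The closed support of \<open>w\<close> is contained in that of \<open>\<psi>\<close> and
  is therefore compact. This admits compositions with functions vanishing at 0 and products with a
  test function.\<close>

lemma test_funs_support_subset:
  assumes "\<psi> \<in> test_funs \<Omega>" "smooth_fun w" "\<And>x. \<psi> x = 0 \<Longrightarrow> w x = 0"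
  shows "w \<in> test_funs \<Omega>"
proof -
  have "tsupp w \<subseteq> tsupp \<psi>"
    unfolding tsupp_def by (rule closure_mono) (use assms(3) in auto)
  moreover have "closed (tsupp w)" "compact (tsupp \<psi>)" "tsupp \<psi> \<subseteq> \<Omega>"
    using assms(1) by (auto simp: tsupp_def test_funs_def)
  ultimately have "compact (tsupp w)"
    using compact_Int_closed[of "tsupp \<psi>" "tsupp w"] by (simp add: Int_absorb1)
  with \<open>tsupp w \<subseteq> tsupp \<psi>\<close> \<open>tsupp \<psi> \<subseteq> \<Omega>\<close> assms(2) show ?thesis
    by (auto simp: test_funs_def)
qed

lemma test_funs_outside: "\<psi> \<in> test_funs \<Omega> \<Longrightarrow> x \<notin> \<Omega> \<Longrightarrow> \<psi> x = 0"
  using closure_subset[of "{x. \<psi> x \<noteq> 0}"] by (auto simp: test_funs_def tsupp_def)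

lemma test_funs_continuous_on: "\<psi> \<in> test_funs \<Omega> \<Longrightarrow> continuous_on A \<psi>"
  by (auto simp: test_funs_def smooth_fun_continuous_on)

lemma test_funs_measurable: "\<psi> \<in> test_funs \<Omega> \<Longrightarrow> \<psi> \<in> borel_measurable lebesgue"
  by (intro measurable_completion) (simp add: borel_measurable_continuous_onI test_funs_continuous_on)

lemma test_funs_bounded:
  assumes "\<psi> \<in> test_funs \<Omega>"
  obtains M where "0 < M" "\<And>x. \<bar>\<psi> x\<bar> \<le> M"
proof -
  have "compact (\<psi> ` tsupp \<psi>)"
    using assms compact_continuous_image[OF test_funs_continuous_on[OF assms]] by (simp add: test_funs_def)
  then obtain M where M: "0 < M" "\<And>x. x \<in> tsupp \<psi> \<Longrightarrow> \<bar>\<psi> x\<bar> \<le> M"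
    using compact_imp_bounded[of "\<psi> ` tsupp \<psi>"] by (auto simp: bounded_pos)
  have "\<bar>\<psi> x\<bar> \<le> M" for x
  proof (cases "\<psi> x = 0")
    case False
    then have "x \<in> tsupp \<psi>" using closure_subset[of "{x. \<psi> x \<noteq> 0}"] by (auto simp: tsupp_def)
    then show ?thesis by (rule M)
  qed (use M in auto)
  with M that show ?thesis by blast
qed

lemma test_funs_mult_const:
  "\<psi> \<in> test_funs \<Omega> \<Longrightarrow> (\<lambda>x. c * \<psi> x) \<in> test_funs \<Omega>"
  by (rule test_funs_support_subset, assumption) (auto simp: test_funs_def intro!: smooth_fun_mult smooth_fun_const)

section \<open>The Gagliardo seminorm\<close>

abbreviation lebesgue2 :: "('a::euclidean_space \<times> 'a) measure" where
  "lebesgue2 \<equiv> lebesgue \<Otimes>\<^sub>M lebesgue"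

lemma sigma_finite_lebesgue: "sigma_finite_measure (lebesgue :: 'a::euclidean_space measure)"
proof
  show "\<exists>A::'a set set. countable A \<and> A \<subseteq> sets lebesgue \<and> \<Union>A = space lebesgue \<and>
      (\<forall>a\<in>A. emeasure lebesgue a \<noteq> \<infinity>)"
    by (intro exI[of _ "range (\<lambda>n::nat. box (- real n *\<^sub>R One) (real n *\<^sub>R One))"])
       (auto simp: emeasure_lborel_cbox_eq UN_box_eq_UNIV)
qed

interpretation lebesgue: sigma_finite_measure lebesgue
  by (rule sigma_finite_lebesgue)

interpretation lebesgue_pair: pair_sigma_finite lebesgue lebesgue ..

lemma frac_kernel_nonneg: "0 \<le> frac_kernel s x y"
  by (simp add: frac_kernel_def)

lemma frac_kernel_pos: "x \<noteq> y \<Longrightarrow> 0 < frac_kernel s x y"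
  by (simp add: frac_kernel_def)

lemma frac_kernel_ge:
  fixes x y :: "'a::euclidean_space"
  assumes "0 < s" "x \<noteq> y" "dist x y \<le> R"
  shows "R powr - (real DIM('a) + 2 * s) \<le> frac_kernel s x y"
proof -
  have "0 < dist x y" "0 < R" using assms by (auto intro: less_le_trans[of _ "dist x y"])
  then show ?thesis
    unfolding frac_kernel_def powr_minus inverse_eq_divide
    by (intro divide_left_mono powr_mono2) (use assms in auto)
qed

lemma measurable_fst_lebesgue [measurable]: "fst \<in> lebesgue2 \<rightarrow>\<^sub>M borel"
  by (rule measurable_compose[OF measurable_fst]) (simp add: measurable_completion)

lemma measurable_snd_lebesgue [measurable]: "snd \<in> lebesgue2 \<rightarrow>\<^sub>M borel"
  by (rule measurable_compose[OF measurable_snd]) (simp add: measurable_completion)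

lemma frac_kernel_measurable [measurable]:
  "(\<lambda>p. frac_kernel s (fst p) (snd p)) \<in> borel_measurable lebesgue2"
  unfolding frac_kernel_def by measurable

text \<open>An exceptional null set N yields the cylinders over N in either variable, both null. In
  this way sign and support information known a.e. enters the double integrals.\<close>

lemma AE_lebesgue2:
  assumes "AE x in lebesgue. P x"
  shows "AE p in lebesgue2. P (fst p) \<and> P (snd p)"
proof -
  from assms obtain N where N: "N \<in> null_sets lebesgue" "{x. \<not> P x} \<subseteq> N"
    by (auto simp: eventually_ae_filter)
  have "N \<times> UNIV \<in> null_sets lebesgue2" "UNIV \<times> N \<in> null_sets lebesgue2"
    using N(1) by (auto simp: null_sets_def lebesgue.emeasure_pair_measure_Times simp del: emeasure_completion)
  then have "N \<times> UNIV \<union> UNIV \<times> N \<in> null_sets lebesgue2"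
    by (rule null_sets.Un)
  then show ?thesis
    by (rule AE_I') (use N(2) in auto)
qed

lemma gagliardo_integrable:
  assumes [measurable]: "u \<in> borel_measurable lebesgue" and "gagliardo_sq s u < \<infinity>"
  shows "integrable lebesgue2 (\<lambda>p. (u (fst p) - u (snd p))\<^sup>2 * frac_kernel s (fst p) (snd p))"
  using assms(2) unfolding gagliardo_sq_def
  by (intro integrableI_nonneg) (auto simp: frac_kernel_nonneg)

lemma frac_form_self:
  assumes [measurable]: "u \<in> borel_measurable lebesgue"
  shows "frac_form s u u = enn2real (gagliardo_sq s u)"
  unfolding frac_form_def gagliardo_sq_def
  by (subst integral_eq_nn_integral) (auto simp: frac_kernel_nonneg power2_eq_square)

lemma gagliardo_frac_form:
  assumes "u \<in> borel_measurable lebesgue" "gagliardo_sq s u < \<infinity>"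
  shows "gagliardo_sq s u = ennreal (frac_form s u u)"
  using assms by (simp add: frac_form_self)

text \<open>Follows from |ab| <= a^2 + b^2. It allows \<open>frac_form\<close> to be split linearly,
  since a Bochner integral that does not exist has the default value 0.\<close>

lemma frac_form_integrable:
  assumes [measurable]: "u \<in> borel_measurable lebesgue" "v \<in> borel_measurable lebesgue"
    and "gagliardo_sq s u < \<infinity>" "gagliardo_sq s v < \<infinity>"
  shows "integrable lebesgue2
    (\<lambda>p. (u (fst p) - u (snd p)) * (v (fst p) - v (snd p)) * frac_kernel s (fst p) (snd p))"
proof (rule Bochner_Integration.integrable_bound)
  show "integrable lebesgue2 (\<lambda>p. (u (fst p) - u (snd p))\<^sup>2 * frac_kernel s (fst p) (snd p) +
     (v (fst p) - v (snd p))\<^sup>2 * frac_kernel s (fst p) (snd p))"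
    using assms by (intro Bochner_Integration.integrable_add gagliardo_integrable)
  have "\<bar>a * b\<bar> \<le> a\<^sup>2 + b\<^sup>2" for a b :: real
  proof -
    have "2 * (\<bar>a\<bar> * \<bar>b\<bar>) \<le> a\<^sup>2 + b\<^sup>2"
      using sum_squares_bound[of "\<bar>a\<bar>" "\<bar>b\<bar>"] by simp
    moreover have "0 \<le> \<bar>a\<bar> * \<bar>b\<bar>"
      by simp
    ultimately show ?thesis
      unfolding abs_mult by linarith
  qed
  then show "AE p in lebesgue2. norm ((u (fst p) - u (snd p)) * (v (fst p) - v (snd p)) * frac_kernel s (fst p) (snd p))
     \<le> norm ((u (fst p) - u (snd p))\<^sup>2 * frac_kernel s (fst p) (snd p) +
     (v (fst p) - v (snd p))\<^sup>2 * frac_kernel s (fst p) (snd p))"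
    by (intro AE_I2) (auto simp: abs_mult distrib_right[symmetric] frac_kernel_nonneg intro!: mult_right_mono)
qed measurable

lemma gagliardo_le_comb:
  assumes [measurable]: "u \<in> borel_measurable lebesgue" "v \<in> borel_measurable lebesgue"
    and "0 \<le> C" "0 \<le> D"
    and "\<And>x y. (w x - w y)\<^sup>2 \<le> C * (u x - u y)\<^sup>2 + D * (v x - v y)\<^sup>2"
  shows "gagliardo_sq s w \<le> ennreal C * gagliardo_sq s u + ennreal D * gagliardo_sq s v"
proof -
  let ?k = "\<lambda>p. frac_kernel s (fst p) (snd p)"
  have "gagliardo_sq s w \<le> (\<integral>\<^sup>+ p. ennreal C * ennreal ((u (fst p) - u (snd p))\<^sup>2 * ?k p)
      + ennreal D * ennreal ((v (fst p) - v (snd p))\<^sup>2 * ?k p) \<partial>lebesgue2)"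
    unfolding gagliardo_sq_def
  proof (intro nn_integral_mono)
    fix p :: "'a \<times> 'a"
    have "(w (fst p) - w (snd p))\<^sup>2 * ?k p \<le>
       C * ((u (fst p) - u (snd p))\<^sup>2 * ?k p) + D * ((v (fst p) - v (snd p))\<^sup>2 * ?k p)"
      using mult_right_mono[OF assms(5) frac_kernel_nonneg[of s "fst p" "snd p"], of "fst p" "snd p"]
      by (simp add: algebra_simps)
    then show "ennreal ((w (fst p) - w (snd p))\<^sup>2 * ?k p) \<le> ennreal C * ennreal ((u (fst p) - u (snd p))\<^sup>2 * ?k p)
      + ennreal D * ennreal ((v (fst p) - v (snd p))\<^sup>2 * ?k p)"
      using assms(3,4) by (simp add: ennreal_mult[symmetric] ennreal_plus[symmetric] frac_kernel_nonneg del: ennreal_plus)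
  qed
  also have "\<dots> = ennreal C * gagliardo_sq s u + ennreal D * gagliardo_sq s v"
    unfolding gagliardo_sq_def by (simp add: nn_integral_add nn_integral_cmult)
  finally show ?thesis .
qed

lemma square_add_le_weighted:
  fixes a b e :: real
  assumes "0 < e"
  shows "(a + b)\<^sup>2 \<le> (1 + e) * a\<^sup>2 + (1 + 1 / e) * b\<^sup>2"
proof -
  have "0 \<le> (e * a - b)\<^sup>2 / e"
    using assms by simp
  also have "\<dots> = e * a\<^sup>2 - 2 * a * b + b\<^sup>2 / e"
    using assms by (simp add: power2_eq_square field_simps)
  finally show ?thesis
    by (simp add: power2_eq_square algebra_simps)
qed

text \<open>The free weight \<open>e\<close> brings the factor of E(u) arbitrarily close to 1, at
  the price of a large factor on a difference that will tend to 0.\<close>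

lemma gagliardo_triangle:
  assumes "u \<in> borel_measurable lebesgue" "v \<in> borel_measurable lebesgue" "0 < e"
  shows "gagliardo_sq s v \<le> ennreal (1 + e) * gagliardo_sq s u +
    ennreal (1 + 1 / e) * gagliardo_sq s (\<lambda>x. v x - u x)"
proof (rule gagliardo_le_comb)
  show "(v x - v y)\<^sup>2 \<le> (1 + e) * (u x - u y)\<^sup>2 + (1 + 1 / e) * (v x - u x - (v y - u y))\<^sup>2" for x y
    using square_add_le_weighted[OF assms(3), of "u x - u y" "v x - u x - (v y - u y)"] by simp
qed (use assms in auto)

section \<open>The energy space: integrability, support and a.e. approximation\<close>

lemma D_s2_0_measurable: "u \<in> D_s2_0 s \<Omega> \<Longrightarrow> u \<in> borel_measurable lebesgue"
  by (simp add: D_s2_0_def)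

lemma test_funs_L2:
  assumes "\<phi> \<in> test_funs \<Omega>"
  shows "(\<integral>\<^sup>+ x. ennreal ((\<phi> x)\<^sup>2) \<partial>lebesgue) < \<infinity>"
proof -
  obtain M where M: "\<And>x. \<bar>\<phi> x\<bar> \<le> M"
    using test_funs_bounded[OF assms] by blast
  have K: "compact (tsupp \<phi>)"
    using assms by (simp add: test_funs_def)
  have "(\<integral>\<^sup>+ x. ennreal ((\<phi> x)\<^sup>2) \<partial>lebesgue) \<le> (\<integral>\<^sup>+ x. ennreal (M\<^sup>2) * indicator (tsupp \<phi>) x \<partial>lebesgue)"
  proof (intro nn_integral_mono)
    fix x
    have "(\<phi> x)\<^sup>2 \<le> M\<^sup>2"
      using power_mono[OF M[of x], of 2] by simp
    moreover have "\<phi> x = 0" if "x \<notin> tsupp \<phi>"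
      using that closure_subset[of "{x. \<phi> x \<noteq> 0}"] by (auto simp: tsupp_def)
    ultimately show "ennreal ((\<phi> x)\<^sup>2) \<le> ennreal (M\<^sup>2) * indicator (tsupp \<phi>) x"
      by (auto simp: indicator_def intro: ennreal_leI)
  qed
  also have "\<dots> = ennreal (M\<^sup>2) * emeasure lebesgue (tsupp \<phi>)"
    using K by (intro nn_integral_cmult_indicator) (auto simp: compact_imp_closed)
  also have "\<dots> < \<infinity>"
    using emeasure_compact_finite[OF K] K by (simp add: ennreal_mult_less_top compact_imp_closed)
  finally show ?thesis .
qed

lemma nn_integral_square_add:
  assumes [measurable]: "f \<in> borel_measurable M" "g \<in> borel_measurable M"
    and "\<And>x. \<bar>h x\<bar> \<le> C * (\<bar>f x\<bar> + \<bar>g x\<bar>)"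
  shows "(\<integral>\<^sup>+ x. ennreal ((h x)\<^sup>2) \<partial>M) \<le>
     ennreal (2 * C\<^sup>2) * ((\<integral>\<^sup>+ x. ennreal ((f x)\<^sup>2) \<partial>M) + (\<integral>\<^sup>+ x. ennreal ((g x)\<^sup>2) \<partial>M))"
proof -
  have "(\<integral>\<^sup>+ x. ennreal ((h x)\<^sup>2) \<partial>M) \<le>
    (\<integral>\<^sup>+ x. ennreal (2 * C\<^sup>2) * (ennreal ((f x)\<^sup>2) + ennreal ((g x)\<^sup>2)) \<partial>M)"
  proof (intro nn_integral_mono)
    fix x
    have "(h x)\<^sup>2 \<le> (C * (\<bar>f x\<bar> + \<bar>g x\<bar>))\<^sup>2"
      using power_mono[OF assms(3)[of x], of 2] by simp
    also have "\<dots> \<le> C\<^sup>2 * (2 * ((f x)\<^sup>2 + (g x)\<^sup>2))"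
      unfolding power_mult_distrib using square_add_le_weighted[of 1 "\<bar>f x\<bar>" "\<bar>g x\<bar>"]
      by (intro mult_left_mono) auto
    finally show "ennreal ((h x)\<^sup>2) \<le> ennreal (2 * C\<^sup>2) * (ennreal ((f x)\<^sup>2) + ennreal ((g x)\<^sup>2))"
      by (simp add: ennreal_mult[symmetric] ennreal_plus[symmetric] ennreal_leI mult.left_commute algebra_simps
          del: ennreal_plus)
  qed
  also have "\<dots> = ennreal (2 * C\<^sup>2) * ((\<integral>\<^sup>+ x. ennreal ((f x)\<^sup>2) \<partial>M) + (\<integral>\<^sup>+ x. ennreal ((g x)\<^sup>2) \<partial>M))"
    by (simp add: nn_integral_cmult nn_integral_add)
  finally show ?thesis .
qed

lemma tendsto_0_imp_eventually_finite:
  fixes X :: "nat \<Rightarrow> ennreal"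
  shows "X \<longlonglongrightarrow> 0 \<Longrightarrow> eventually (\<lambda>k. X k < \<infinity>) sequentially"
  by (rule order_tendstoD) auto

lemma D_s2_0_L2:
  assumes "u \<in> D_s2_0 s \<Omega>"
  shows "(\<integral>\<^sup>+ x. ennreal ((u x)\<^sup>2) \<partial>lebesgue) < \<infinity>"
proof -
  obtain \<phi> where \<phi>: "\<And>k. \<phi> k \<in> test_funs \<Omega>"
    "(\<lambda>k. \<integral>\<^sup>+ x. ennreal ((\<phi> k x - u x)\<^sup>2) \<partial>lebesgue) \<longlonglongrightarrow> 0"
    using assms by (auto simp: D_s2_0_def)
  from tendsto_0_imp_eventually_finite[OF \<phi>(2)] obtain k where
    k: "(\<integral>\<^sup>+ x. ennreal ((\<phi> k x - u x)\<^sup>2) \<partial>lebesgue) < \<infinity>"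
    by (auto simp: eventually_sequentially)
  have [measurable]: "u \<in> borel_measurable lebesgue" "\<phi> k \<in> borel_measurable lebesgue"
    using D_s2_0_measurable[OF assms] test_funs_measurable[OF \<phi>(1)] by auto
  have "(\<integral>\<^sup>+ x. ennreal ((u x)\<^sup>2) \<partial>lebesgue) \<le> ennreal (2 * 1\<^sup>2) *
     ((\<integral>\<^sup>+ x. ennreal ((\<phi> k x - u x)\<^sup>2) \<partial>lebesgue) + (\<integral>\<^sup>+ x. ennreal ((\<phi> k x)\<^sup>2) \<partial>lebesgue))"
    by (rule nn_integral_square_add) auto
  also have "\<dots> < \<infinity>"
    using k test_funs_L2[OF \<phi>(1)[of k]] by (simp add: ennreal_mult_less_top)
  finally show ?thesis .
qed

text \<open>Test functions vanish off \<Omega>, so the integral of u^2 over the complement is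
  bounded by the squared L2 distance to every approximant.\<close>

lemma D_s2_0_outside:
  assumes "u \<in> D_s2_0 s \<Omega>" and [measurable]: "\<Omega> \<in> sets lebesgue"
  shows "AE x in lebesgue. x \<notin> \<Omega> \<longrightarrow> u x = 0"
proof -
  obtain \<phi> where \<phi>: "\<And>k. \<phi> k \<in> test_funs \<Omega>"
    "(\<lambda>k. \<integral>\<^sup>+ x. ennreal ((\<phi> k x - u x)\<^sup>2) \<partial>lebesgue) \<longlonglongrightarrow> 0"
    using assms by (auto simp: D_s2_0_def)
  have [measurable]: "u \<in> borel_measurable lebesgue"
    using assms by (auto simp: D_s2_0_measurable)
  have "(\<integral>\<^sup>+ x. ennreal ((u x)\<^sup>2) * indicator (-\<Omega>) x \<partial>lebesgue) \<le> (\<integral>\<^sup>+ x. ennreal ((\<phi> k x - u x)\<^sup>2) \<partial>lebesgue)" for k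
    by (intro nn_integral_mono) (auto simp: indicator_def test_funs_outside[OF \<phi>(1)])
  then have "(\<integral>\<^sup>+ x. ennreal ((u x)\<^sup>2) * indicator (-\<Omega>) x \<partial>lebesgue) \<le> 0"
    by (intro LIMSEQ_le_const[OF \<phi>(2)]) auto
  then have "AE x in lebesgue. ennreal ((u x)\<^sup>2) * indicator (-\<Omega>) x = 0"
    by (subst nn_integral_0_iff_AE[symmetric]) auto
  then show ?thesis
    by eventually_elim (auto simp: indicator_def split: if_splits)
qed

text \<open>L2 convergence gives a.e. convergence along a subsequence, the form in which Fatou's
  lemma and dominated convergence use the approximation.\<close>

lemma D_s2_0_approx:
  assumes "u \<in> D_s2_0 s \<Omega>"
  obtains \<phi> where "\<And>k. \<phi> k \<in> test_funs \<Omega>"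
    "(\<lambda>k. gagliardo_sq s (\<lambda>x. \<phi> k x - u x)) \<longlonglongrightarrow> 0"
    "(\<lambda>k. \<integral>\<^sup>+ x. ennreal ((\<phi> k x - u x)\<^sup>2) \<partial>lebesgue) \<longlonglongrightarrow> 0"
    "AE x in lebesgue. (\<lambda>k. \<phi> k x) \<longlonglongrightarrow> u x"
proof -
  obtain \<phi> where \<phi>: "\<And>k. \<phi> k \<in> test_funs \<Omega>"
    "(\<lambda>k. gagliardo_sq s (\<lambda>x. \<phi> k x - u x)) \<longlonglongrightarrow> 0"
    "(\<lambda>k. \<integral>\<^sup>+ x. ennreal ((\<phi> k x - u x)\<^sup>2) \<partial>lebesgue) \<longlonglongrightarrow> 0" (is "?I \<longlonglongrightarrow> 0")
    using assms by (auto simp: D_s2_0_def)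
  from tendsto_0_imp_eventually_finite[OF \<phi>(3)] obtain m where
    m: "\<And>k. k \<ge> m \<Longrightarrow> ?I k < \<infinity>"
    by (auto simp: eventually_sequentially)
  have [measurable]: "u \<in> borel_measurable lebesgue" "\<phi> k \<in> borel_measurable lebesgue" for k
    using D_s2_0_measurable[OF assms] test_funs_measurable[OF \<phi>(1)] by auto
  \<comment> \<open>The shift by \<open>m\<close> discards initial terms whose L2 distance to
    \<open>u\<close> may be infinite.\<close>
  let ?f = "\<lambda>k x. (\<phi> (k + m) x - u x)\<^sup>2"
  have int: "integrable lebesgue (?f k)" for k
    using m[of "k + m"] by (intro integrableI_nonneg) auto
  have "(\<integral>x. norm (?f k x) \<partial>lebesgue) = enn2real (?I (k + m))" for k
    by (subst integral_eq_nn_integral) auto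
  moreover have "(\<lambda>k. enn2real (?I (k + m))) \<longlonglongrightarrow> 0"
    using tendsto_enn2real[of _ 0 sequentially] LIMSEQ_ignore_initial_segment[OF \<phi>(3), of m] by simp
  ultimately have "(\<lambda>k. \<integral>x. norm (?f k x) \<partial>lebesgue) \<longlonglongrightarrow> 0"
    by simp
  from tendsto_L1_AE_subseq[OF int this] obtain r where
    r: "strict_mono r" "AE x in lebesgue. (\<lambda>k. ?f (r k) x) \<longlonglongrightarrow> 0"
    by blast
  let ?r = "\<lambda>k. r k + m"
  have sm: "strict_mono ?r"
    using r(1) by (auto simp: strict_mono_def)
  have "AE x in lebesgue. (\<lambda>k. \<phi> (?r k) x) \<longlonglongrightarrow> u x"
    using r(2)
  proof eventually_elim
    case (elim x)
    then have "(\<lambda>k. sqrt (?f (r k) x)) \<longlonglongrightarrow> sqrt 0"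
      by (rule tendsto_real_sqrt)
    then show ?case
      by (simp add: LIM_zero_iff tendsto_rabs_zero_iff)
  qed
  moreover have "(\<lambda>k. gagliardo_sq s (\<lambda>x. \<phi> (?r k) x - u x)) \<longlonglongrightarrow> 0" "(\<lambda>k. ?I (?r k)) \<longlonglongrightarrow> 0"
    using LIMSEQ_subseq_LIMSEQ[OF \<phi>(2) sm] LIMSEQ_subseq_LIMSEQ[OF \<phi>(3) sm] by (auto simp: o_def)
  ultimately show ?thesis
    using \<phi>(1) by (intro that[of "\<lambda>k. \<phi> (?r k)"]) auto
qed

section \<open>Lipschitz superposition operators\<close>

lemma ennreal_tendsto_0_le:
  fixes X Y :: "nat \<Rightarrow> ennreal"
  assumes "Y \<longlonglongrightarrow> 0" "\<And>k. X k \<le> Y k"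
  shows "X \<longlonglongrightarrow> 0"
  by (rule tendsto_sandwich[of "\<lambda>_. 0" X sequentially Y]) (use assms in auto)

text \<open>Generalised dominated convergence: the dominating functions vary with the approximation,
  but they converge in the mean, so the truncated remainder is dominated by a fixed function.\<close>

lemma nn_integral_square_tendsto_0:
  fixes D H :: "nat \<Rightarrow> 'b \<Rightarrow> real"
  assumes [measurable]: "\<And>k. D k \<in> borel_measurable M" "\<And>k. H k \<in> borel_measurable M"
        "V \<in> borel_measurable M" "\<kappa> \<in> borel_measurable M"
      and \<kappa>: "\<And>p. 0 \<le> \<kappa> p"
      and D: "AE p in M. (\<lambda>k. D k p) \<longlonglongrightarrow> 0"
      and le: "\<And>k p. (D k p)\<^sup>2 \<le> H k p + V p" "\<And>k p. 0 \<le> H k p" "\<And>p. 0 \<le> V p"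
      and H: "(\<lambda>k. \<integral>\<^sup>+ p. ennreal (H k p * \<kappa> p) \<partial>M) \<longlonglongrightarrow> 0"
      and V: "(\<integral>\<^sup>+ p. ennreal (V p * \<kappa> p) \<partial>M) < \<infinity>"
  shows "(\<lambda>k. \<integral>\<^sup>+ p. ennreal ((D k p)\<^sup>2 * \<kappa> p) \<partial>M) \<longlonglongrightarrow> 0"
proof -
  let ?T = "\<lambda>k p. max 0 ((D k p)\<^sup>2 - H k p) * \<kappa> p"
  have "(\<lambda>k. \<integral>\<^sup>+ p. ennreal (?T k p) \<partial>M) \<longlonglongrightarrow> (\<integral>\<^sup>+ p. 0 \<partial>M)"
  proof (rule nn_integral_dominated_convergence[OF _ _ _ _ V])
    show "AE p in M. ennreal (?T k p) \<le> ennreal (V p * \<kappa> p)" for k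
      using le(1)[of k] \<kappa> le(3) by (intro AE_I2 ennreal_leI mult_right_mono) (auto simp: diff_le_eq add.commute)
    show "AE p in M. (\<lambda>k. ennreal (?T k p)) \<longlonglongrightarrow> 0"
      using D
    proof eventually_elim
      case (elim p)
      have "(\<lambda>k. (D k p)\<^sup>2 * \<kappa> p) \<longlonglongrightarrow> 0\<^sup>2 * \<kappa> p"
        by (intro tendsto_intros elim)
      then have "(\<lambda>k. ?T k p) \<longlonglongrightarrow> 0"
        by (intro Lim_null_comparison[of "\<lambda>k. ?T k p" "\<lambda>k. (D k p)\<^sup>2 * \<kappa> p"] always_eventually allI)
          (auto simp: \<kappa> le(2) intro!: mult_right_mono)
      from tendsto_ennrealI[OF this] show ?case
        by simp
    qed
  qed auto
  then have "(\<lambda>k. (\<integral>\<^sup>+ p. ennreal (?T k p) \<partial>M) + (\<integral>\<^sup>+ p. ennreal (H k p * \<kappa> p) \<partial>M)) \<longlonglongrightarrow> 0"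
    using tendsto_add[OF _ H] by fastforce
  moreover have "(\<integral>\<^sup>+ p. ennreal ((D k p)\<^sup>2 * \<kappa> p) \<partial>M) \<le>
      (\<integral>\<^sup>+ p. ennreal (?T k p) \<partial>M) + (\<integral>\<^sup>+ p. ennreal (H k p * \<kappa> p) \<partial>M)" for k
  proof -
    have "(D k p)\<^sup>2 * \<kappa> p \<le> ?T k p + H k p * \<kappa> p" for p
      using \<kappa>[of p] by (simp add: distrib_right[symmetric] mult_right_mono)
    then have "(\<integral>\<^sup>+ p. ennreal ((D k p)\<^sup>2 * \<kappa> p) \<partial>M) \<le> (\<integral>\<^sup>+ p. ennreal (?T k p) + ennreal (H k p * \<kappa> p) \<partial>M)"
      by (intro nn_integral_mono) (simp add: \<kappa> le(2) ennreal_plus[symmetric] ennreal_leI del: ennreal_plus)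
    then show ?thesis
      by (simp add: nn_integral_add)
  qed
  ultimately show ?thesis
    by (rule ennreal_tendsto_0_le)
qed

lemma nn_integral_comb_finite:
  fixes f g :: "'b \<Rightarrow> real"
  assumes [measurable]: "f \<in> borel_measurable M" "g \<in> borel_measurable M"
    and nn: "\<And>p. 0 \<le> f p" "\<And>p. 0 \<le> g p"
    and fin: "(\<integral>\<^sup>+ p. ennreal (f p) \<partial>M) < \<infinity>" "(\<integral>\<^sup>+ p. ennreal (g p) \<partial>M) < \<infinity>"
    and c: "0 \<le> c"
  shows "(\<integral>\<^sup>+ p. ennreal (c * f p + c * g p) \<partial>M) < \<infinity>"
proof -
  have "(\<integral>\<^sup>+ p. ennreal (c * f p + c * g p) \<partial>M) =
     ennreal c * (\<integral>\<^sup>+ p. ennreal (f p) \<partial>M) + ennreal c * (\<integral>\<^sup>+ p. ennreal (g p) \<partial>M)"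
    using nn c by (simp add: nn_integral_add nn_integral_cmult ennreal_mult)
  also have "\<dots> < \<infinity>"
    using fin by (simp add: ennreal_mult_less_top)
  finally show ?thesis .
qed

lemma nn_integral_cmult_tendsto_0:
  fixes f :: "nat \<Rightarrow> 'b \<Rightarrow> real"
  assumes [measurable]: "\<And>k. f k \<in> borel_measurable M" and nn: "\<And>k p. 0 \<le> f k p"
    and f: "(\<lambda>k. \<integral>\<^sup>+ p. ennreal (f k p) \<partial>M) \<longlonglongrightarrow> 0"
    and c: "0 \<le> c"
  shows "(\<lambda>k. \<integral>\<^sup>+ p. ennreal (c * f k p) \<partial>M) \<longlonglongrightarrow> 0"
proof -
  have "(\<lambda>k. ennreal c * (\<integral>\<^sup>+ p. ennreal (f k p) \<partial>M)) \<longlonglongrightarrow> ennreal c * 0"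
    by (intro ennreal_tendsto_cmult f) auto
  then show ?thesis
    using nn c by (simp add: nn_integral_cmult ennreal_mult)
qed

text \<open>A Lipschitz superposition operator is in general not Lipschitz in the energy seminorm,
  so convergence comes from a.e. convergence and a majorant built from \<open>\<phi> k - u\<close>,
  \<open>u\<close> and \<open>\<psi>\<close>. The regularisations \<open>F k\<close> keep the
  approximants among the test functions although \<open>G\<close> may fail to be smooth;
  \<open>\<psi>\<close> carries the dependence of \<open>G\<close> on the point.\<close>

lemma D_s2_0_compose:
  fixes F :: "nat \<Rightarrow> 'a::euclidean_space \<Rightarrow> real \<Rightarrow> real"
  assumes u: "u \<in> D_s2_0 s \<Omega>" "gagliardo_sq s u < \<infinity>"
    and \<psi> [measurable]: "\<psi> \<in> borel_measurable lebesgue"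
    and \<psi>_fin: "gagliardo_sq s \<psi> < \<infinity>" "(\<integral>\<^sup>+ x. ennreal ((\<psi> x)\<^sup>2) \<partial>lebesgue) < \<infinity>"
    and test: "\<And>k \<phi>. \<phi> \<in> test_funs \<Omega> \<Longrightarrow> (\<lambda>x. F k x (\<phi> x)) \<in> test_funs \<Omega>"
    and lim: "\<And>x a. (\<lambda>k. F k x a) \<longlonglongrightarrow> G x a"
    and lip: "\<And>k x y a b. \<bar>F k x a - F k y b\<bar> \<le> C * (\<bar>a - b\<bar> + \<bar>\<psi> x - \<psi> y\<bar>)"
    and bnd: "\<And>k x a. \<bar>F k x a\<bar> \<le> C * (\<bar>a\<bar> + \<bar>\<psi> x\<bar>)"
    and w [measurable]: "(\<lambda>x. G x (u x)) \<in> borel_measurable lebesgue"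
  shows "(\<lambda>x. G x (u x)) \<in> D_s2_0 s \<Omega>"
    and "gagliardo_sq s (\<lambda>x. G x (u x)) < \<infinity>"
proof -
  obtain \<phi> where \<phi>: "\<And>k. \<phi> k \<in> test_funs \<Omega>"
    "(\<lambda>k. gagliardo_sq s (\<lambda>x. \<phi> k x - u x)) \<longlonglongrightarrow> 0"
    "(\<lambda>k. \<integral>\<^sup>+ x. ennreal ((\<phi> k x - u x)\<^sup>2) \<partial>lebesgue) \<longlonglongrightarrow> 0"
    "AE x in lebesgue. (\<lambda>k. \<phi> k x) \<longlonglongrightarrow> u x"
    by (rule D_s2_0_approx[OF u(1)]) blast
  define w where "w = (\<lambda>x. G x (u x))"
  define W where "W = (\<lambda>k x. F k x (\<phi> k x))"
  have [measurable]: "u \<in> borel_measurable lebesgue" "\<phi> k \<in> borel_measurable lebesgue"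
     "W k \<in> borel_measurable lebesgue" "w \<in> borel_measurable lebesgue" for k
    using D_s2_0_measurable[OF u(1)] test_funs_measurable[OF \<phi>(1)]
      test_funs_measurable[OF test[OF \<phi>(1)]] w by (auto simp: w_def W_def)
  \<comment> \<open>The constant \<open>C\<close> does not depend on \<open>k\<close>, so the bounds
    pass to the limit \<open>G\<close>.\<close>
  have lipG: "\<bar>G x a - G y b\<bar> \<le> C * (\<bar>a - b\<bar> + \<bar>\<psi> x - \<psi> y\<bar>)" for x y a b
    by (rule LIMSEQ_le_const2[OF tendsto_rabs[OF tendsto_diff[OF lim lim]]]) (use lip in blast)
  have bndG: "\<bar>G x a\<bar> \<le> C * (\<bar>a\<bar> + \<bar>\<psi> x\<bar>)" for x a
    by (rule LIMSEQ_le_const2[OF tendsto_rabs[OF lim]]) (use bnd in blast)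
  have sq_le: "d\<^sup>2 \<le> 2 * C\<^sup>2 * a\<^sup>2 + 2 * C\<^sup>2 * b\<^sup>2" if "\<bar>d\<bar> \<le> C * (\<bar>a\<bar> + \<bar>b\<bar>)" for d a b :: real
  proof -
    have "d\<^sup>2 \<le> (C * (\<bar>a\<bar> + \<bar>b\<bar>))\<^sup>2"
      using power_mono[OF that, of 2] by simp
    also have "\<dots> \<le> C\<^sup>2 * (2 * (a\<^sup>2 + b\<^sup>2))"
      unfolding power_mult_distrib using square_add_le_weighted[of 1 "\<bar>a\<bar>" "\<bar>b\<bar>"]
      by (intro mult_left_mono) auto
    finally show ?thesis
      by (simp add: algebra_simps)
  qed
  have "gagliardo_sq s w \<le> ennreal (2 * C\<^sup>2) * gagliardo_sq s u + ennreal (2 * C\<^sup>2) * gagliardo_sq s \<psi>"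
    by (rule gagliardo_le_comb) (auto simp: w_def intro: sq_le lipG)
  also have "\<dots> < \<infinity>"
    using u(2) \<psi>_fin(1) by (simp add: ennreal_mult_less_top)
  finally show w_fin: "gagliardo_sq s (\<lambda>x. G x (u x)) < \<infinity>"
    by (simp add: w_def)
  have conv: "AE x in lebesgue. (\<lambda>k. W k x) \<longlonglongrightarrow> w x"
    using \<phi>(4)
  proof eventually_elim
    case (elim x)
    have "(\<lambda>k. C * \<bar>\<phi> k x - u x\<bar>) \<longlonglongrightarrow> C * \<bar>u x - u x\<bar>"
      by (intro tendsto_intros elim)
    then have "(\<lambda>k. C * \<bar>\<phi> k x - u x\<bar>) \<longlonglongrightarrow> 0"
      by simp
    moreover have "norm (F k x (\<phi> k x) - F k x (u x)) \<le> C * \<bar>\<phi> k x - u x\<bar>" for k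
      using lip[of k x _ x] by simp
    ultimately have "(\<lambda>k. F k x (\<phi> k x) - F k x (u x)) \<longlonglongrightarrow> 0"
      by (rule Lim_null_comparison[OF always_eventually[OF allI], rotated])
    from tendsto_add[OF this lim[of x "u x"]] show ?case
      by (simp add: W_def w_def)
  qed
  \<comment> \<open>Here \<open>e\<close> stands for \<open>\<phi> k - u\<close>, \<open>a\<close>
    for \<open>u\<close> and \<open>b\<close> for \<open>\<psi>\<close>, or for their increments.
    Writing \<open>\<phi> k\<close> as \<open>u\<close> plus an error separates a part that vanishes
    in the mean from a fixed integrable part. The factors 8 and 16 come from repeated use of (a +
    b)^2 <= 2 a^2 + 2 b^2, rounded up.\<close>
  have bound: "d\<^sup>2 \<le> 8 * C\<^sup>2 * e\<^sup>2 + (16 * C\<^sup>2 * a\<^sup>2 + 16 * C\<^sup>2 * b\<^sup>2)"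
    if d: "d = d1 - d2" and d1: "\<bar>d1\<bar> \<le> C * (\<bar>e + a\<bar> + \<bar>b\<bar>)" and d2: "\<bar>d2\<bar> \<le> C * (\<bar>a\<bar> + \<bar>b\<bar>)"
    for d d1 d2 e a b :: real
  proof -
    have "d\<^sup>2 \<le> 2 * d1\<^sup>2 + 2 * d2\<^sup>2"
      using square_add_le_weighted[of 1 d1 "- d2"] d by simp
    moreover have "C\<^sup>2 * (e + a)\<^sup>2 \<le> C\<^sup>2 * (2 * e\<^sup>2 + 2 * a\<^sup>2)"
      using square_add_le_weighted[of 1 e a] by (intro mult_left_mono) auto
    moreover have "0 \<le> C\<^sup>2 * a\<^sup>2" "0 \<le> C\<^sup>2 * b\<^sup>2" "0 \<le> C\<^sup>2 * e\<^sup>2"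
      by auto
    ultimately show ?thesis
      using sq_le[OF d1] sq_le[OF d2] unfolding distrib_left by linarith
  qed
  \<comment> \<open>The weight is 1 for the L2 distance and the kernel for the energy below, so both
    follow from the same convergence result.\<close>
  have "(\<lambda>k. \<integral>\<^sup>+ x. ennreal ((W k x - w x)\<^sup>2 * 1) \<partial>lebesgue) \<longlonglongrightarrow> 0"
  proof (rule nn_integral_square_tendsto_0[where H = "\<lambda>k x. 8 * C\<^sup>2 * (\<phi> k x - u x)\<^sup>2" and V = "\<lambda>x. 16 * C\<^sup>2 * (u x)\<^sup>2 + 16 * C\<^sup>2 * (\<psi> x)\<^sup>2"])
    show "AE x in lebesgue. (\<lambda>k. W k x - w x) \<longlonglongrightarrow> 0"
      using conv by eventually_elim (rule LIM_zero)
    show "(W k x - w x)\<^sup>2 \<le> 8 * C\<^sup>2 * (\<phi> k x - u x)\<^sup>2 + (16 * C\<^sup>2 * (u x)\<^sup>2 + 16 * C\<^sup>2 * (\<psi> x)\<^sup>2)" for k x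
      by (rule bound[OF refl]) (use bnd bndG in \<open>auto simp: W_def w_def\<close>)
    show "(\<integral>\<^sup>+ x. ennreal ((16 * C\<^sup>2 * (u x)\<^sup>2 + 16 * C\<^sup>2 * (\<psi> x)\<^sup>2) * 1) \<partial>lebesgue) < \<infinity>"
      unfolding mult_1_right
      by (rule nn_integral_comb_finite) (use D_s2_0_L2[OF u(1)] \<psi>_fin(2) in auto)
    show "(\<lambda>k. \<integral>\<^sup>+ x. ennreal (8 * C\<^sup>2 * (\<phi> k x - u x)\<^sup>2 * 1) \<partial>lebesgue) \<longlonglongrightarrow> 0"
      unfolding mult_1_right
      by (rule nn_integral_cmult_tendsto_0) (use \<phi>(3) in auto)
  qed auto
  moreover have "(\<lambda>k. gagliardo_sq s (\<lambda>x. W k x - w x)) \<longlonglongrightarrow> 0"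
    unfolding gagliardo_sq_def
  proof (rule nn_integral_square_tendsto_0[where H = "\<lambda>k p. 8 * C\<^sup>2 * ((\<phi> k (fst p) - u (fst p)) - (\<phi> k (snd p) - u (snd p)))\<^sup>2" and
      V = "\<lambda>p. 16 * C\<^sup>2 * (u (fst p) - u (snd p))\<^sup>2 + 16 * C\<^sup>2 * (\<psi> (fst p) - \<psi> (snd p))\<^sup>2"])
    show "AE p in lebesgue2. (\<lambda>k. W k (fst p) - w (fst p) - (W k (snd p) - w (snd p))) \<longlonglongrightarrow> 0"
      using AE_lebesgue2[OF conv]
    proof eventually_elim
      case (elim p)
      have "(\<lambda>k. W k (fst p) - w (fst p) - (W k (snd p) - w (snd p))) \<longlonglongrightarrow>
         w (fst p) - w (fst p) - (w (snd p) - w (snd p))"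
        using elim by (intro tendsto_intros) auto
      then show ?case by simp
    qed
    show "(W k (fst p) - w (fst p) - (W k (snd p) - w (snd p)))\<^sup>2
         \<le> 8 * C\<^sup>2 * (\<phi> k (fst p) - u (fst p) - (\<phi> k (snd p) - u (snd p)))\<^sup>2 +
           (16 * C\<^sup>2 * (u (fst p) - u (snd p))\<^sup>2 + 16 * C\<^sup>2 * (\<psi> (fst p) - \<psi> (snd p))\<^sup>2)" for k p
    proof (rule bound)
      show "W k (fst p) - w (fst p) - (W k (snd p) - w (snd p)) =
        (W k (fst p) - W k (snd p)) - (w (fst p) - w (snd p))"
        by simp
    qed (use lip[of k "fst p" "\<phi> k (fst p)" "snd p" "\<phi> k (snd p)"]
            lipG[of "fst p" "u (fst p)" "snd p" "u (snd p)"] in \<open>auto simp: W_def w_def\<close>)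
    have "(\<lambda>k. \<integral>\<^sup>+ p. ennreal (8 * C\<^sup>2 * ((\<phi> k (fst p) - u (fst p) - (\<phi> k (snd p) - u (snd p)))\<^sup>2 *
        frac_kernel s (fst p) (snd p))) \<partial>lebesgue2) \<longlonglongrightarrow> 0"
      using \<phi>(2) by (intro nn_integral_cmult_tendsto_0) (auto simp: frac_kernel_nonneg gagliardo_sq_def)
    then show "(\<lambda>k. \<integral>\<^sup>+ p. ennreal (8 * C\<^sup>2 * (\<phi> k (fst p) - u (fst p) - (\<phi> k (snd p) - u (snd p)))\<^sup>2 *
        frac_kernel s (fst p) (snd p)) \<partial>lebesgue2) \<longlonglongrightarrow> 0"
      by (simp add: mult.assoc)
    have "(\<integral>\<^sup>+ p. ennreal (16 * C\<^sup>2 * ((u (fst p) - u (snd p))\<^sup>2 * frac_kernel s (fst p) (snd p)) +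
        16 * C\<^sup>2 * ((\<psi> (fst p) - \<psi> (snd p))\<^sup>2 * frac_kernel s (fst p) (snd p))) \<partial>lebesgue2) < \<infinity>"
      using u(2) \<psi>_fin(1) by (intro nn_integral_comb_finite) (auto simp: frac_kernel_nonneg gagliardo_sq_def)
    then show "(\<integral>\<^sup>+ p. ennreal ((16 * C\<^sup>2 * (u (fst p) - u (snd p))\<^sup>2 + 16 * C\<^sup>2 * (\<psi> (fst p) - \<psi> (snd p))\<^sup>2) *
        frac_kernel s (fst p) (snd p)) \<partial>lebesgue2) < \<infinity>"
      by (simp add: algebra_simps)
  qed (auto simp: frac_kernel_nonneg)
  moreover have "W k \<in> test_funs \<Omega>" for k
    unfolding W_def by (rule test[OF \<phi>(1)])
  ultimately have "w \<in> D_s2_0 s \<Omega>"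
    unfolding D_s2_0_def by (auto intro!: exI[of _ W])
  then show "(\<lambda>x. G x (u x)) \<in> D_s2_0 s \<Omega>"
    by (simp add: w_def)
qed

section \<open>Regularised modulus, negative part and Picone quotient\<close>

lemma abs_sqrt_diff_le: "\<bar>sqrt (a\<^sup>2 + d\<^sup>2) - sqrt (b\<^sup>2 + d\<^sup>2)\<bar> \<le> \<bar>a - b\<bar>"
  \<comment> \<open>The square roots are the moduli of \<open>Complex a d\<close> and
    \<open>Complex b d\<close>, which makes the Lipschitz constant independent of
    \<open>d\<close>.\<close>
  using norm_triangle_ineq3[of "Complex a d" "Complex b d"] by (simp add: complex_norm cmod_def)

lemma sqrt_delta_tendsto: "(\<lambda>k. sqrt (a\<^sup>2 + (inverse (real (Suc k)))\<^sup>2)) \<longlonglongrightarrow> \<bar>a\<bar>"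
proof -
  have "(\<lambda>k. sqrt (a\<^sup>2 + (inverse (real (Suc k)))\<^sup>2)) \<longlonglongrightarrow> sqrt (a\<^sup>2 + 0\<^sup>2)"
    by (intro tendsto_intros LIMSEQ_inverse_real_of_nat)
  then show ?thesis by simp
qed

lemma sqrt_delta_bounds:
  assumes "0 < d"
  shows "\<bar>a\<bar> \<le> sqrt (a\<^sup>2 + d\<^sup>2)" "d \<le> sqrt (a\<^sup>2 + d\<^sup>2)" "sqrt (a\<^sup>2 + d\<^sup>2) \<le> \<bar>a\<bar> + d"
proof -
  show "\<bar>a\<bar> \<le> sqrt (a\<^sup>2 + d\<^sup>2)" "d \<le> sqrt (a\<^sup>2 + d\<^sup>2)"
    by (auto intro: real_le_rsqrt)
  show "sqrt (a\<^sup>2 + d\<^sup>2) \<le> \<bar>a\<bar> + d"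
    using sqrt_sum_squares_le_sum_abs[of a d] assms by simp
qed

lemma smooth_fun_sqrt_delta:
  assumes "smooth_fun u" "0 < d"
  shows "smooth_fun (\<lambda>x. sqrt ((u x)\<^sup>2 + d\<^sup>2))"
proof (rule smooth_fun_sqrt)
  show "smooth_fun (\<lambda>x. (u x)\<^sup>2 + d\<^sup>2)"
    unfolding power2_eq_square by (intro smooth_fun_add smooth_fun_mult smooth_fun_const assms)
  show "0 < (u x)\<^sup>2 + d\<^sup>2" for x
    using assms(2) by (simp add: add_nonneg_pos)
qed

lemma D_s2_0_abs:
  fixes u :: "'a::euclidean_space \<Rightarrow> real"
  assumes "u \<in> D_s2_0 s \<Omega>" "gagliardo_sq s u < \<infinity>"
  shows "(\<lambda>x. \<bar>u x\<bar>) \<in> D_s2_0 s \<Omega>"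
proof -
  let ?d = "\<lambda>k. inverse (real (Suc k))"
  \<comment> \<open>Subtracting \<open>?d k\<close> makes the regularised modulus vanish at 0, so
    that supports do not grow.\<close>
  let ?F = "\<lambda>k (x::'a) a. sqrt (a\<^sup>2 + (?d k)\<^sup>2) - ?d k"
  show ?thesis
  proof (rule D_s2_0_compose(1)[OF assms, where F = ?F and G = "\<lambda>x a. \<bar>a\<bar>" and \<psi> = "\<lambda>_. 0" and C = 1])
    fix k \<phi> assume \<phi>: "\<phi> \<in> test_funs \<Omega>"
    then have "smooth_fun \<phi>" by (simp add: test_funs_def)
    then have "smooth_fun (\<lambda>x. ?F k x (\<phi> x))"
      by (intro smooth_fun_diff smooth_fun_sqrt_delta smooth_fun_const) auto
    then show "(\<lambda>x. ?F k x (\<phi> x)) \<in> test_funs \<Omega>"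
      by (rule test_funs_support_subset[OF \<phi>]) simp
  next
    fix a show "(\<lambda>k. ?F k x a) \<longlonglongrightarrow> \<bar>a\<bar>" for x
      using tendsto_diff[OF sqrt_delta_tendsto LIMSEQ_inverse_real_of_nat] by simp
  next
    fix k x y a b
    show "\<bar>?F k x a - ?F k y b\<bar> \<le> 1 * (\<bar>a - b\<bar> + \<bar>0 - 0\<bar>)"
      using abs_sqrt_diff_le[of a "?d k" b] by simp
    show "\<bar>?F k x a\<bar> \<le> 1 * (\<bar>a\<bar> + \<bar>0\<bar>)"
      using sqrt_delta_bounds[of "?d k" a] by (simp add: abs_le_iff)
  qed (use D_s2_0_measurable[OF assms(1)] in \<open>auto simp: gagliardo_sq_def\<close>)
qed

lemma D_s2_0_neg_part:
  fixes u :: "'a::euclidean_space \<Rightarrow> real"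
  assumes "u \<in> D_s2_0 s \<Omega>" "gagliardo_sq s u < \<infinity>"
  shows "(\<lambda>x. max 0 (- u x)) \<in> D_s2_0 s \<Omega>" "gagliardo_sq s (\<lambda>x. max 0 (- u x)) < \<infinity>"
proof -
  let ?d = "\<lambda>k. inverse (real (Suc k))"
  \<comment> \<open>The negative part is (|a| - a) / 2; its regularisation again vanishes at
    0.\<close>
  let ?F = "\<lambda>k (x::'a) a. 1/2 * (sqrt (a\<^sup>2 + (?d k)\<^sup>2) - ?d k - a)"
  have 1: "(\<lambda>x. ?F k x (\<phi> x)) \<in> test_funs \<Omega>" if \<phi>: "\<phi> \<in> test_funs \<Omega>" for k \<phi>
  proof -
    have "smooth_fun \<phi>" using \<phi> by (simp add: test_funs_def)
    then have "smooth_fun (\<lambda>x. ?F k x (\<phi> x))"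
      by (intro smooth_fun_diff smooth_fun_sqrt_delta smooth_fun_const smooth_fun_mult) auto
    then show ?thesis
      by (rule test_funs_support_subset[OF \<phi>]) simp
  qed
  have 2: "(\<lambda>k. ?F k x a) \<longlonglongrightarrow> max 0 (- a)" for x :: 'a and a
  proof -
    have "(\<lambda>k. ?F k x a) \<longlonglongrightarrow> 1/2 * (\<bar>a\<bar> - 0 - a)"
      by (intro tendsto_intros sqrt_delta_tendsto LIMSEQ_inverse_real_of_nat)
    moreover have "1/2 * (\<bar>a\<bar> - 0 - a) = max 0 (- a)" by auto
    ultimately show ?thesis by simp
  qed
  have 3: "\<bar>?F k x a - ?F k y b\<bar> \<le> 1 * (\<bar>a - b\<bar> + \<bar>0 - 0\<bar>)"
      "\<bar>?F k x a\<bar> \<le> 1 * (\<bar>a\<bar> + \<bar>0\<bar>)" for k a b and x y :: 'a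
  proof -
    have "0 < ?d k" by simp
    note X = sqrt_delta_bounds[OF this, of a] abs_sqrt_diff_le[of a "?d k" b]
    have "\<bar>1/2 * (p - d - a) - 1/2 * (r - d - b)\<bar> \<le> 1 * (\<bar>a - b\<bar> + \<bar>0 - 0\<bar>)"
      if "\<bar>p - r\<bar> \<le> \<bar>a - b\<bar>" for p r d :: real
    proof -
      have "\<bar>((p - r) - (a - b)) / 2\<bar> \<le> \<bar>a - b\<bar>"
        using that abs_triangle_ineq4[of "p - r" "a - b"] by simp
      moreover have "1/2 * (p - d - a) - 1/2 * (r - d - b) = ((p - r) - (a - b)) / 2"
        by (simp add: field_simps)
      ultimately show ?thesis
        by (simp only:) simp
    qed
    then show "\<bar>?F k x a - ?F k y b\<bar> \<le> 1 * (\<bar>a - b\<bar> + \<bar>0 - 0\<bar>)"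
      using X(4) by blast
    have "\<bar>1/2 * (p - d - a)\<bar> \<le> 1 * (\<bar>a\<bar> + \<bar>0\<bar>)"
      if "\<bar>a\<bar> \<le> p" "d \<le> p" "p \<le> \<bar>a\<bar> + d" for p d :: real
      using that by simp
    then show "\<bar>?F k x a\<bar> \<le> 1 * (\<bar>a\<bar> + \<bar>0\<bar>)"
      using X(1-3) by blast
  qed
  have 4: "(\<lambda>x. max 0 (- u x)) \<in> borel_measurable lebesgue"
    using D_s2_0_measurable[OF assms(1)] by auto
  note * = D_s2_0_compose[OF assms, where F = ?F and G = "\<lambda>x a. max 0 (- a)" and \<psi> = "\<lambda>_. 0" and C = 1,
      OF _ _ _ 1 2 3 4]
  show "(\<lambda>x. max 0 (- u x)) \<in> D_s2_0 s \<Omega>" "gagliardo_sq s (\<lambda>x. max 0 (- u x)) < \<infinity>"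
    by (rule *; simp add: gagliardo_sq_def)+
qed

text \<open>The difference splits into a change of the numerator and a change of the denominator,
  with both denominators at least \<open>e\<close>. It supplies the joint Lipschitz bound for the
  Picone quotient.\<close>

lemma square_div_lipschitz:
  fixes p r A B e M :: real
  assumes e: "0 < e" "e \<le> A" "e \<le> B" and M: "\<bar>p\<bar> \<le> M" "\<bar>r\<bar> \<le> M"
  shows "\<bar>p * p * inverse A - r * r * inverse B\<bar> \<le> (2 * M / e) * \<bar>p - r\<bar> + (M\<^sup>2 / e\<^sup>2) * \<bar>A - B\<bar>"
proof -
  have inv: "0 < inverse A" "inverse A \<le> inverse e" "0 < inverse B" "inverse B \<le> inverse e"
    using e by (auto intro: le_imp_inverse_le)
  have "0 \<le> M" using M by linarith
  have "p * p * inverse A - r * r * inverse B =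
      (p - r) * (p + r) * inverse A + (r * r) * (B - A) * (inverse A * inverse B)"
    using e by (simp add: field_simps)
  also have "\<bar>\<dots>\<bar> \<le> \<bar>(p - r) * (p + r) * inverse A\<bar> + \<bar>(r * r) * (B - A) * (inverse A * inverse B)\<bar>"
    by (rule abs_triangle_ineq)
  also have "\<bar>(p - r) * (p + r) * inverse A\<bar> = \<bar>p - r\<bar> * \<bar>p + r\<bar> * inverse A"
    using inv by (simp only: abs_mult abs_of_pos)
  also have "\<dots> \<le> \<bar>p - r\<bar> * (2 * M) * inverse e"
    using inv M \<open>0 \<le> M\<close> abs_triangle_ineq[of p r] by (intro mult_mono) auto
  also have "\<bar>(r * r) * (B - A) * (inverse A * inverse B)\<bar> = (\<bar>r\<bar> * \<bar>r\<bar>) * \<bar>A - B\<bar> * (inverse A * inverse B)"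
    using inv by (simp only: abs_mult abs_of_pos abs_minus_commute)
  also have "\<dots> \<le> (M * M) * \<bar>A - B\<bar> * (inverse e * inverse e)"
    using inv M \<open>0 \<le> M\<close> e by (intro mult_mono) auto
  finally show ?thesis
    by (simp add: power2_eq_square divide_inverse algebra_simps)
qed

lemma D_s2_0_square_div:
  assumes u: "u \<in> D_s2_0 s \<Omega>" "gagliardo_sq s u < \<infinity>"
    and \<psi>: "\<psi> \<in> test_funs \<Omega>" "gagliardo_sq s \<psi> < \<infinity>" and e: "0 < e"
  shows "(\<lambda>x. (\<psi> x)\<^sup>2 / (\<bar>u x\<bar> + e)) \<in> D_s2_0 s \<Omega>" "gagliardo_sq s (\<lambda>x. (\<psi> x)\<^sup>2 / (\<bar>u x\<bar> + e)) < \<infinity>"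
proof -
  let ?d = "\<lambda>k. inverse (real (Suc k))"
  let ?S = "\<lambda>k a. sqrt (a\<^sup>2 + (?d k)\<^sup>2) + e"
  let ?F = "\<lambda>k x a. (\<psi> x * \<psi> x) * inverse (?S k a)"
  obtain M where M: "0 < M" "\<And>x. \<bar>\<psi> x\<bar> \<le> M"
    using test_funs_bounded[OF \<psi>(1)] by blast
  \<comment> \<open>The first summand is the Lipschitz constant in \<open>\<psi>\<close>, the second
    the one in \<open>u\<close>. The sum serves for both and, being at least M / e, for the growth
    bound too.\<close>
  define C where "C = 2 * M / e + M\<^sup>2 / e\<^sup>2"
  have S: "e \<le> ?S k a" "0 < ?S k a" for k a
    using sqrt_delta_bounds[of "?d k" a] e by (auto intro!: add_nonneg_pos)
  have inv: "0 < inverse (?S k a)" "inverse (?S k a) \<le> 1 / e" for k a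
    using S[where k=k and a=a] e by (auto simp: inverse_eq_divide intro!: divide_left_mono)
  have 1: "(\<lambda>x. ?F k x (\<phi> x)) \<in> test_funs \<Omega>" if \<phi>: "\<phi> \<in> test_funs \<Omega>" for k \<phi>
  proof -
    have "smooth_fun \<phi>" "smooth_fun \<psi>" using \<phi> \<psi>(1) by (simp_all add: test_funs_def)
    then have "smooth_fun (\<lambda>x. ?F k x (\<phi> x))"
      by (intro smooth_fun_mult smooth_fun_inverse smooth_fun_add smooth_fun_sqrt_delta smooth_fun_const S) auto
    then show ?thesis
      by (rule test_funs_support_subset[OF \<psi>(1)]) simp
  qed
  have 2: "(\<lambda>k. ?F k x a) \<longlonglongrightarrow> (\<psi> x)\<^sup>2 / (\<bar>a\<bar> + e)" for x a
  proof -
    have "(\<lambda>k. ?F k x a) \<longlonglongrightarrow> (\<psi> x * \<psi> x) * inverse (\<bar>a\<bar> + e)"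
      using e by (intro tendsto_intros sqrt_delta_tendsto) auto
    then show ?thesis by (simp add: power2_eq_square divide_inverse)
  qed
  have 3: "\<bar>?F k x a - ?F k y b\<bar> \<le> C * (\<bar>a - b\<bar> + \<bar>\<psi> x - \<psi> y\<bar>)" for k x y a b
  proof -
    have "\<bar>?F k x a - ?F k y b\<bar> \<le> (2 * M / e) * \<bar>\<psi> x - \<psi> y\<bar> + (M\<^sup>2 / e\<^sup>2) * \<bar>?S k a - ?S k b\<bar>"
      by (rule square_div_lipschitz[OF e S(1) S(1) M(2) M(2)])
    also have "\<dots> \<le> C * \<bar>\<psi> x - \<psi> y\<bar> + C * \<bar>a - b\<bar>"
    proof (intro add_mono mult_mono)
      show "\<bar>?S k a - ?S k b\<bar> \<le> \<bar>a - b\<bar>"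
        using abs_sqrt_diff_le[of a "?d k" b] by simp
    qed (use M(1) e in \<open>auto simp: C_def\<close>)
    finally show ?thesis by (simp add: algebra_simps)
  qed
  have 4: "\<bar>?F k x a\<bar> \<le> C * (\<bar>a\<bar> + \<bar>\<psi> x\<bar>)" for k x a
  proof -
    have "\<bar>?F k x a\<bar> = (\<bar>\<psi> x\<bar> * \<bar>\<psi> x\<bar>) * inverse (?S k a)"
      using inv by (simp only: abs_mult abs_of_pos)
    also have "\<dots> \<le> (\<bar>\<psi> x\<bar> * M) * (1 / e)"
      using M(1) inv(2)[where k=k and a=a] less_imp_le[OF inv(1)[where k=k and a=a]]
      by (intro mult_mono mult_left_mono M(2)) auto
    also have "\<dots> = (M / e) * \<bar>\<psi> x\<bar>" by simp
    also have "\<dots> \<le> C * (\<bar>a\<bar> + \<bar>\<psi> x\<bar>)"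
      using M(1) e unfolding C_def by (intro mult_mono) (auto simp: field_simps)
    finally show ?thesis .
  qed
  have [measurable]: "u \<in> borel_measurable lebesgue" "\<psi> \<in> borel_measurable lebesgue"
    using D_s2_0_measurable[OF u(1)] test_funs_measurable[OF \<psi>(1)] by auto
  have 5: "(\<lambda>x. (\<psi> x)\<^sup>2 / (\<bar>u x\<bar> + e)) \<in> borel_measurable lebesgue"
    by measurable
  note * = D_s2_0_compose[OF u, where F = ?F and G = "\<lambda>x a. (\<psi> x)\<^sup>2 / (\<bar>a\<bar> + e)" and \<psi> = \<psi> and C = C,
      OF test_funs_measurable[OF \<psi>(1)] \<psi>(2) test_funs_L2[OF \<psi>(1)] 1 2 3 4 5]
  show "(\<lambda>x. (\<psi> x)\<^sup>2 / (\<bar>u x\<bar> + e)) \<in> D_s2_0 s \<Omega>" "gagliardo_sq s (\<lambda>x. (\<psi> x)\<^sup>2 / (\<bar>u x\<bar> + e)) < \<infinity>"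
    using * by (simp_all only:)
qed

section \<open>The variational inequality and the Poincare inequality\<close>

lemma gagliardo_cmult:
  assumes [measurable]: "u \<in> borel_measurable lebesgue"
  shows "gagliardo_sq s (\<lambda>x. c * u x) = ennreal (c\<^sup>2) * gagliardo_sq s u"
proof -
  have "ennreal ((c * a - c * b)\<^sup>2 * frac_kernel s x y) = ennreal (c\<^sup>2) * ennreal ((a - b)\<^sup>2 * frac_kernel s x y)"
    for a b and x y :: 'a
    by (simp add: ennreal_mult[symmetric] frac_kernel_nonneg right_diff_distrib[symmetric]
        power_mult_distrib mult.assoc)
  then show ?thesis
    unfolding gagliardo_sq_def by (simp add: nn_integral_cmult)
qed

lemma gagliardo_lipschitz:
  assumes "\<And>x y. \<bar>w x - w y\<bar> \<le> \<bar>u x - u y\<bar>"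
  shows "gagliardo_sq s w \<le> gagliardo_sq s u"
  unfolding gagliardo_sq_def
  by (intro nn_integral_mono ennreal_leI mult_right_mono frac_kernel_nonneg)
    (use assms in \<open>auto simp: abs_le_square_iff\<close>)

lemma Lq_norm_cmult:
  assumes [measurable]: "u \<in> borel_measurable lebesgue" "\<Omega> \<in> sets lebesgue" and "0 < q"
  shows "Lq_norm q \<Omega> (\<lambda>x. c * u x) = \<bar>c\<bar> * Lq_norm q \<Omega> u"
proof -
  have "(\<integral>\<^sup>+ x\<in>\<Omega>. ennreal (\<bar>c * u x\<bar> powr q) \<partial>lebesgue) =
     (\<integral>\<^sup>+ x. ennreal (\<bar>c\<bar> powr q) * (ennreal (\<bar>u x\<bar> powr q) * indicator \<Omega> x) \<partial>lebesgue)"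
    by (intro nn_integral_cong) (auto simp: abs_mult powr_mult ennreal_mult indicator_def)
  also have "\<dots> = ennreal (\<bar>c\<bar> powr q) * (\<integral>\<^sup>+ x\<in>\<Omega>. ennreal (\<bar>u x\<bar> powr q) \<partial>lebesgue)"
    by (intro nn_integral_cmult) auto
  finally show ?thesis
    using assms(3) by (simp add: Lq_norm_def enn2real_mult powr_mult powr_powr)
qed

text \<open>\<open>enn2real\<close> maps \<infinity> to 0, so the norm value 1 excludes an infinite
  integral.\<close>

lemma Lq_norm_eq_1D:
  assumes "Lq_norm q \<Omega> u = 1" "0 < q"
  shows "(\<integral>\<^sup>+ x\<in>\<Omega>. ennreal (\<bar>u x\<bar> powr q) \<partial>lebesgue) = 1" (is "?I = 1")
proof -
  have "enn2real ?I \<noteq> 0" "?I \<noteq> \<infinity>"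
    using assms by (auto simp: Lq_norm_def)
  moreover from this have "0 < enn2real ?I"
    using enn2real_nonneg[of ?I] by linarith
  moreover have "enn2real ?I powr (1 / q) = 1"
    using assms by (simp add: Lq_norm_def)
  ultimately have "enn2real ?I = 1"
    using powr_eq_one_iff_gen[of "enn2real ?I" "1 / q"] assms(2)
    by (metis divide_eq_0_iff less_irrefl zero_neq_one)
  then show ?thesis
    using \<open>?I \<noteq> \<infinity>\<close> by (metis ennreal_1 ennreal_enn2real infinity_ennreal_def less_top)
qed

text \<open>If the infimum is \<infinity>, then \<open>Lambda_q\<close> is 0 by the convention for
  \<open>enn2real\<close>, and the bound still holds.\<close>

lemma Lambda_q_le_test_fun:
  assumes "\<phi> \<in> test_funs \<Omega>" "Lq_norm q \<Omega> \<phi> = 1"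
  shows "ennreal (Lambda_q s q \<Omega>) \<le> gagliardo_sq s \<phi>"
proof -
  have "ennreal (enn2real y) \<le> y" for y
    by (cases y) auto
  then have "ennreal (Lambda_q s q \<Omega>) \<le> (INF \<phi>\<in>{\<phi>\<in>test_funs \<Omega>. Lq_norm q \<Omega> \<phi> = 1}. gagliardo_sq s \<phi>)"
    by (simp add: Lambda_q_def)
  also have "\<dots> \<le> gagliardo_sq s \<phi>"
    by (rule INF_lower) (use assms in auto)
  finally show ?thesis .
qed

lemma Lambda_q_nonneg: "0 \<le> Lambda_q s q \<Omega>"
  by (simp add: Lambda_q_def)

lemma Lambda_q_mult_le_test_fun:
  assumes "\<phi> \<in> test_funs \<Omega>" "0 < Lq_norm q \<Omega> \<phi>" "0 < q" "\<Omega> \<in> sets lebesgue"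
  shows "ennreal (Lambda_q s q \<Omega> * (Lq_norm q \<Omega> \<phi>)\<^sup>2) \<le> gagliardo_sq s \<phi>"
proof -
  define N where "N = Lq_norm q \<Omega> \<phi>"
  have N: "0 < N" using assms by (simp add: N_def)
  have [measurable]: "\<phi> \<in> borel_measurable lebesgue"
    by (rule test_funs_measurable[OF assms(1)])
  have "ennreal (Lambda_q s q \<Omega>) \<le> gagliardo_sq s (\<lambda>x. 1 / N * \<phi> x)"
  proof (rule Lambda_q_le_test_fun)
    show "Lq_norm q \<Omega> (\<lambda>x. 1 / N * \<phi> x) = 1"
      using N by (subst Lq_norm_cmult) (use assms in \<open>auto simp: N_def\<close>)
  qed (rule test_funs_mult_const[OF assms(1)])
  also have "\<dots> = ennreal ((1 / N)\<^sup>2) * gagliardo_sq s \<phi>"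
    by (rule gagliardo_cmult) simp
  finally have "ennreal (N\<^sup>2) * ennreal (Lambda_q s q \<Omega>) \<le> ennreal (N\<^sup>2) * (ennreal ((1 / N)\<^sup>2) * gagliardo_sq s \<phi>)"
    by (rule mult_left_mono) simp
  moreover have "ennreal (N\<^sup>2) * (ennreal ((1 / N)\<^sup>2) * gagliardo_sq s \<phi>) = gagliardo_sq s \<phi>"
    using N by (simp add: mult.assoc[symmetric] ennreal_mult[symmetric] power_divide)
  ultimately show ?thesis
    by (simp add: N_def ennreal_mult[symmetric] Lambda_q_nonneg mult.commute)
qed

locale sublinear_domain =
  fixes s q :: real and \<Omega> :: "'a::euclidean_space set"
  assumes s_pos: "0 < s" and q_gt: "1 < q" and q_less: "q < 2"
    and bounded_domain: "bounded \<Omega>" and open_domain: "open \<Omega>"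
begin

lemma domain_measurable [measurable]: "\<Omega> \<in> sets lebesgue"
  using open_domain by auto

lemma domain_finite: "emeasure lebesgue \<Omega> < \<infinity>"
  using bounded_domain open_domain emeasure_bounded_finite[of \<Omega>] by simp

lemma test_funs_Lq_finite:
  assumes "\<phi> \<in> test_funs \<Omega>"
  shows "(\<integral>\<^sup>+ x\<in>\<Omega>. ennreal (\<bar>\<phi> x\<bar> powr q) \<partial>lebesgue) < \<infinity>"
proof -
  obtain M where M: "\<And>x. \<bar>\<phi> x\<bar> \<le> M"
    using test_funs_bounded[OF assms] by blast
  have "(\<integral>\<^sup>+ x\<in>\<Omega>. ennreal (\<bar>\<phi> x\<bar> powr q) \<partial>lebesgue) \<le> (\<integral>\<^sup>+ x\<in>\<Omega>. ennreal (M powr q) \<partial>lebesgue)"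
    using M q_gt by (intro nn_integral_mono mult_right_mono ennreal_leI powr_mono2) auto
  also have "\<dots> = ennreal (M powr q) * emeasure lebesgue \<Omega>"
    by (rule nn_integral_cmult_indicator) simp
  also have "\<dots> < \<infinity>"
    using domain_finite by (simp add: ennreal_mult_less_top)
  finally show ?thesis .
qed

text \<open>A density argument. Fatou's lemma only gives that the integrals of |\<phi>|^q along the
  approximation have lower limit at least 1, but this is the direction required: a norm that is at
  least nearly 1 already bounds the energy from below.\<close>

lemma Lambda_q_le:
  assumes u: "u \<in> D_s2_0 s \<Omega>" "gagliardo_sq s u < \<infinity>" and norm: "Lq_norm q \<Omega> u = 1"
  shows "ennreal (Lambda_q s q \<Omega>) \<le> gagliardo_sq s u"
proof -
  define L where "L = Lambda_q s q \<Omega>"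
  define e where "e = enn2real (gagliardo_sq s u)"
  have e: "gagliardo_sq s u = ennreal e" "0 \<le> e"
    using u(2) by (auto simp: e_def)
  obtain \<phi> where \<phi>: "\<And>k. \<phi> k \<in> test_funs \<Omega>"
    "(\<lambda>k. gagliardo_sq s (\<lambda>x. \<phi> k x - u x)) \<longlonglongrightarrow> 0"
    "AE x in lebesgue. (\<lambda>k. \<phi> k x) \<longlonglongrightarrow> u x"
    by (rule D_s2_0_approx[OF u(1)]) blast
  have [measurable]: "u \<in> borel_measurable lebesgue" "\<phi> k \<in> borel_measurable lebesgue" for k
    using D_s2_0_measurable[OF u(1)] test_funs_measurable[OF \<phi>(1)] by auto
  let ?I = "\<lambda>k. \<integral>\<^sup>+ x\<in>\<Omega>. ennreal (\<bar>\<phi> k x\<bar> powr q) \<partial>lebesgue"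
  have "1 = (\<integral>\<^sup>+ x. liminf (\<lambda>k. ennreal (\<bar>\<phi> k x\<bar> powr q) * indicator \<Omega> x) \<partial>lebesgue)"
    unfolding Lq_norm_eq_1D[OF norm less_trans[OF zero_less_one q_gt], symmetric]
  proof (intro nn_integral_cong_AE)
    show "AE x in lebesgue. ennreal (\<bar>u x\<bar> powr q) * indicator \<Omega> x =
       liminf (\<lambda>k. ennreal (\<bar>\<phi> k x\<bar> powr q) * indicator \<Omega> x)"
      using \<phi>(3)
    proof eventually_elim
      case (elim x)
      have "(\<lambda>k. ennreal (\<bar>\<phi> k x\<bar> powr q)) \<longlonglongrightarrow> ennreal (\<bar>u x\<bar> powr q)"
        using q_gt by (intro tendsto_ennrealI tendsto_powr2 tendsto_rabs elim tendsto_const) auto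
      then have "(\<lambda>k. ennreal (\<bar>\<phi> k x\<bar> powr q) * indicator \<Omega> x) \<longlonglongrightarrow> ennreal (\<bar>u x\<bar> powr q) * indicator \<Omega> x"
        by (auto simp: indicator_def)
      then show ?case
        by (rule lim_imp_Liminf[OF trivial_limit_sequentially, symmetric])
    qed
  qed
  also have "\<dots> \<le> liminf ?I"
    by (rule nn_integral_liminf) simp
  finally have liminf: "1 \<le> liminf ?I" .
  have main: "L \<le> (1 + \<eta>)\<^sup>2 * e" if \<eta>: "0 < \<eta>" for \<eta>
  proof -
    \<comment> \<open>Chosen so that \<open>\<rho> powr (2 / q)\<close> is 1 / (1 + \<eta>). This
      loss in the norm and the factor 1 + \<eta> of the weighted triangle inequality make up the
      square in \<open>main\<close>.\<close>
    define \<rho> where "\<rho> = (1 / (1 + \<eta>)) powr (q / 2)"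
    have "\<rho> < 1 powr (q / 2)" "0 < \<rho>"
      using \<eta> q_gt powr_less_mono2[of "q / 2" "1 / (1 + \<eta>)" 1] unfolding \<rho>_def by auto
    then have \<rho>: "\<rho> < 1" "0 < \<rho>"
      by auto
    then have "ennreal \<rho> < 1"
      by (simp add: ennreal_less_one_iff)
    then have "ennreal \<rho> < liminf ?I"
      using liminf by (rule less_le_trans)
    then have "eventually (\<lambda>k. ennreal \<rho> < ?I k) sequentially"
      by (rule less_LiminfD)
    then have "eventually (\<lambda>k. ennreal (L / (1 + \<eta>)) \<le> gagliardo_sq s (\<phi> k)) sequentially"
    proof eventually_elim
      case (elim k)
      have fin: "?I k = ennreal (enn2real (?I k))"
        using test_funs_Lq_finite[OF \<phi>(1)[of k]] by simp
      have "\<rho> \<le> enn2real (?I k)"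
        using elim \<rho>(2) by (subst (asm) fin) (simp add: ennreal_less_iff)
      then have "\<rho> powr (2 / q) \<le> enn2real (?I k) powr (2 / q)"
        using \<rho> q_gt by (intro powr_mono2) auto
      moreover have "\<rho> powr (2 / q) = 1 / (1 + \<eta>)"
        using q_gt \<eta> unfolding \<rho>_def powr_powr by simp
      moreover have "(Lq_norm q \<Omega> (\<phi> k))\<^sup>2 = enn2real (?I k) powr (2 / q)"
        by (simp add: Lq_norm_def power2_eq_square powr_add[symmetric])
      ultimately have N: "1 / (1 + \<eta>) \<le> (Lq_norm q \<Omega> (\<phi> k))\<^sup>2"
        by simp
      have "0 < Lq_norm q \<Omega> (\<phi> k)"
      proof (rule ccontr)
        assume "\<not> 0 < Lq_norm q \<Omega> (\<phi> k)"
        then have "Lq_norm q \<Omega> (\<phi> k) = 0"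
          by (simp add: Lq_norm_def)
        with N \<eta> show False
          by (simp add: field_simps)
      qed
      from Lambda_q_mult_le_test_fun[OF \<phi>(1) this, of s]
      have "ennreal (L * (Lq_norm q \<Omega> (\<phi> k))\<^sup>2) \<le> gagliardo_sq s (\<phi> k)"
        using q_gt by (simp add: L_def)
      moreover have "L * (1 / (1 + \<eta>)) \<le> L * (Lq_norm q \<Omega> (\<phi> k))\<^sup>2"
        by (rule mult_left_mono[OF N]) (simp add: L_def Lambda_q_nonneg)
      ultimately show ?case
        by (metis (no_types, lifting) ennreal_leI mult_1_right order_trans times_divide_eq_right)
    qed
    then have "eventually (\<lambda>k. ennreal (L / (1 + \<eta>)) \<le> ennreal (1 + \<eta>) * gagliardo_sq s u +
       ennreal (1 + 1 / \<eta>) * gagliardo_sq s (\<lambda>x. \<phi> k x - u x)) sequentially"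
    proof eventually_elim
      case (elim k)
      also have "gagliardo_sq s (\<phi> k) \<le> ennreal (1 + \<eta>) * gagliardo_sq s u +
          ennreal (1 + 1 / \<eta>) * gagliardo_sq s (\<lambda>x. \<phi> k x - u x)"
        by (rule gagliardo_triangle[OF _ _ \<eta>]) auto
      finally show ?case .
    qed
    moreover have "(\<lambda>k. ennreal (1 + \<eta>) * gagliardo_sq s u +
       ennreal (1 + 1 / \<eta>) * gagliardo_sq s (\<lambda>x. \<phi> k x - u x)) \<longlonglongrightarrow>
         ennreal (1 + \<eta>) * gagliardo_sq s u + ennreal (1 + 1 / \<eta>) * 0"
      by (intro tendsto_add tendsto_const ennreal_tendsto_cmult \<phi>(2)) auto
    ultimately have "ennreal (L / (1 + \<eta>)) \<le> ennreal (1 + \<eta>) * gagliardo_sq s u + ennreal (1 + 1 / \<eta>) * 0"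
      by (intro tendsto_le[OF trivial_limit_sequentially _ tendsto_const])
    also have "\<dots> = ennreal ((1 + \<eta>) * e)"
      using \<eta> e by (simp add: ennreal_mult)
    finally have "L / (1 + \<eta>) \<le> (1 + \<eta>) * e"
      using \<eta> e(2) by (simp add: ennreal_le_iff)
    then show ?thesis
      using \<eta> by (simp add: field_simps power2_eq_square)
  qed
  have "(\<lambda>n. (1 + inverse (real (Suc n)))\<^sup>2 * e) \<longlonglongrightarrow> (1 + 0)\<^sup>2 * e"
    by (intro tendsto_intros LIMSEQ_inverse_real_of_nat)
  then have "L \<le> (1 + 0)\<^sup>2 * e"
    by (rule LIMSEQ_le_const) (use main in auto)
  then show ?thesis
    unfolding e(1) L_def[symmetric] by (simp add: ennreal_leI)
qed

end

section \<open>Poincare inequality and interaction of disjoint supports\<close>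

lemma ball_diff_emeasure:
  fixes x :: "'a::euclidean_space"
  assumes A [measurable]: "A \<in> sets lebesgue" and "0 \<le> m" "emeasure lebesgue A \<le> ennreal m"
    and R: "2 * m \<le> measure lebesgue (ball (0::'a) R)"
  shows "ennreal (measure lebesgue (ball (0::'a) R) / 2) \<le> emeasure lebesgue (ball x R - A)"
proof -
  let ?V = "measure lebesgue (ball (0::'a) R)"
  have "ennreal ?V = emeasure lebesgue (ball x R)"
  proof (cases "0 \<le> R")
    case True
    then have "?V = measure lebesgue (ball x R)"
      by (simp add: content_ball)
    then show ?thesis
      using emeasure_lborel_ball_finite[of x R] by (simp add: emeasure_eq_ennreal_measure)
  next
    case False
    then have "ball x R = {}" "ball (0::'a) R = {}" by auto
    then show ?thesis by (simp only:) simp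
  qed
  \<comment> \<open>Removing \<open>A\<close> costs at most \<open>m\<close>, which is no more than
    half of the volume of the ball.\<close>
  also have "\<dots> \<le> emeasure lebesgue ((ball x R - A) \<union> A)"
    by (rule emeasure_mono) auto
  also have "\<dots> \<le> emeasure lebesgue (ball x R - A) + emeasure lebesgue A"
    by (rule emeasure_subadditive) auto
  also have "\<dots> \<le> emeasure lebesgue (ball x R - A) + ennreal m"
    using assms(3) by (rule add_left_mono)
  finally have "ennreal ?V \<le> emeasure lebesgue (ball x R - A) + ennreal m" .
  moreover have "emeasure lebesgue (ball x R - A) = ennreal r \<Longrightarrow> 0 \<le> r \<Longrightarrow> ?V \<le> r + m" for r
    using calculation assms(2) by (simp add: ennreal_plus[symmetric] ennreal_le_iff del: ennreal_plus)
  ultimately show ?thesis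
    using R by (cases "emeasure lebesgue (ball x R - A)") (auto intro!: ennreal_leI)
qed

text \<open>A function vanishing off a small set interacts with its zero set inside a ball of
  twice the volume; this gives the Poincare inequality with a constant that blows up as the
  support shrinks.\<close>

lemma gagliardo_poincare:
  fixes f :: "'a::euclidean_space \<Rightarrow> real"
  assumes [measurable]: "f \<in> borel_measurable lebesgue" and A [measurable]: "A \<in> sets lebesgue"
    and f: "AE x in lebesgue. x \<notin> A \<longrightarrow> f x = 0" and s: "0 < s"
    and m: "0 \<le> m" "emeasure lebesgue A \<le> ennreal m" "2 * m \<le> measure lebesgue (ball (0::'a) R)"
  shows "ennreal (measure lebesgue (ball (0::'a) R) / 2 * R powr - (real DIM('a) + 2 * s)) *
     (\<integral>\<^sup>+ x. ennreal ((f x)\<^sup>2) \<partial>lebesgue) \<le> gagliardo_sq s f"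
proof -
  let ?k = "R powr - (real DIM('a) + 2 * s)" and ?V = "measure lebesgue (ball (0::'a) R) / 2"
  have "ennreal (?V * ?k) * (\<integral>\<^sup>+ x. ennreal ((f x)\<^sup>2) \<partial>lebesgue) =
    (\<integral>\<^sup>+ x. ennreal (?V * ?k) * ennreal ((f x)\<^sup>2) \<partial>lebesgue)"
    by (rule nn_integral_cmult[symmetric]) simp
  also have "\<dots> \<le> (\<integral>\<^sup>+ x. \<integral>\<^sup>+ y. ennreal ((f x - f y)\<^sup>2 * frac_kernel s x y) \<partial>lebesgue \<partial>lebesgue)"
  proof (intro nn_integral_mono_AE)
    show "AE x in lebesgue. ennreal (?V * ?k) * ennreal ((f x)\<^sup>2)
        \<le> (\<integral>\<^sup>+ y. ennreal ((f x - f y)\<^sup>2 * frac_kernel s x y) \<partial>lebesgue)"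
      using f
    proof eventually_elim
      case (elim x)
      show ?case
      proof (cases "f x = 0")
        case False
        with elim have x: "x \<in> A" by blast
        have "ennreal (?V * ?k) * ennreal ((f x)\<^sup>2) = ennreal (?k * (f x)\<^sup>2) * ennreal ?V"
          by (simp add: ennreal_mult[symmetric] ac_simps)
        also have "\<dots> \<le> ennreal (?k * (f x)\<^sup>2) * emeasure lebesgue (ball x R - A)"
          by (intro mult_left_mono ball_diff_emeasure[OF A m]) simp
        also have "\<dots> = (\<integral>\<^sup>+ y\<in>ball x R - A. ennreal (?k * (f x)\<^sup>2) \<partial>lebesgue)"
          by (rule nn_integral_cmult_indicator[symmetric]) auto
        also have "\<dots> \<le> (\<integral>\<^sup>+ y. ennreal ((f x - f y)\<^sup>2 * frac_kernel s x y) \<partial>lebesgue)"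
        proof (intro nn_integral_mono_AE)
          show "AE y in lebesgue. ennreal (?k * (f x)\<^sup>2) * indicator (ball x R - A) y
             \<le> ennreal ((f x - f y)\<^sup>2 * frac_kernel s x y)"
            using f
          proof eventually_elim
            case (elim y)
            show ?case
            proof (cases "y \<in> ball x R - A")
              case True
              with elim have "f y = 0" by blast
              moreover have "?k \<le> frac_kernel s x y"
                using True x s by (intro frac_kernel_ge) auto
              ultimately show ?thesis
                using True mult_right_mono[of ?k "frac_kernel s x y" "(f x)\<^sup>2"]
                by (auto intro!: ennreal_leI simp: mult.commute)
            qed simp
          qed
        qed
        finally show ?thesis .
      qed simp
    qed
  qed
  also have "\<dots> = gagliardo_sq s f"
    unfolding gagliardo_sq_def
    by (subst lebesgue.nn_integral_fst[symmetric]) auto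
  finally show ?thesis .
qed

text \<open>Tonelli turns the product of the masses into a double integral, and the kernel is
  bounded below on pairs in \<Omega>. Disjointness keeps these pairs off the diagonal, where
  \<open>frac_kernel\<close> has the default value 0.\<close>

lemma nn_integral_kernel_product_ge:
  fixes u w :: "'a::euclidean_space \<Rightarrow> real"
  assumes [measurable]: "u \<in> borel_measurable lebesgue" "w \<in> borel_measurable lebesgue"
    and nn: "\<And>x. 0 \<le> u x" "\<And>x. 0 \<le> w x" and disj: "\<And>x. u x * w x = 0"
    and supp: "AE x in lebesgue. x \<notin> \<Omega> \<longrightarrow> u x = 0 \<and> w x = 0"
    and R: "\<And>x y. x \<in> \<Omega> \<Longrightarrow> y \<in> \<Omega> \<Longrightarrow> dist x y \<le> R" and s: "0 < s"
  shows "ennreal (R powr - (real DIM('a) + 2 * s)) *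
      ((\<integral>\<^sup>+ x. ennreal (u x) \<partial>lebesgue) * (\<integral>\<^sup>+ x. ennreal (w x) \<partial>lebesgue)) \<le>
    (\<integral>\<^sup>+ p. ennreal (u (fst p) * w (snd p) * frac_kernel s (fst p) (snd p)) \<partial>lebesgue2)"
proof -
  let ?k = "R powr - (real DIM('a) + 2 * s)"
  have "(\<integral>\<^sup>+ x. ennreal (u x) \<partial>lebesgue) * (\<integral>\<^sup>+ x. ennreal (w x) \<partial>lebesgue) =
    (\<integral>\<^sup>+ x. \<integral>\<^sup>+ y. ennreal (u x) * ennreal (w y) \<partial>lebesgue \<partial>lebesgue)"
    by (simp add: nn_integral_cmult nn_integral_multc)
  also have "\<dots> = (\<integral>\<^sup>+ p. ennreal (u (fst p)) * ennreal (w (snd p)) \<partial>lebesgue2)"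
    by (subst lebesgue.nn_integral_fst[symmetric]) auto
  finally have "ennreal ?k * ((\<integral>\<^sup>+ x. ennreal (u x) \<partial>lebesgue) * (\<integral>\<^sup>+ x. ennreal (w x) \<partial>lebesgue)) =
    (\<integral>\<^sup>+ p. ennreal ?k * (ennreal (u (fst p)) * ennreal (w (snd p))) \<partial>lebesgue2)"
    by (simp add: nn_integral_cmult)
  also have "\<dots> \<le> (\<integral>\<^sup>+ p. ennreal (u (fst p) * w (snd p) * frac_kernel s (fst p) (snd p)) \<partial>lebesgue2)"
  proof (rule nn_integral_mono_AE)
    show "AE p in lebesgue2. ennreal ?k * (ennreal (u (fst p)) * ennreal (w (snd p)))
       \<le> ennreal (u (fst p) * w (snd p) * frac_kernel s (fst p) (snd p))"
      using AE_lebesgue2[OF supp]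
    proof eventually_elim
      case (elim p)
      show ?case
      proof (cases "u (fst p) = 0 \<or> w (snd p) = 0")
        case False
        then have "fst p \<in> \<Omega>" "snd p \<in> \<Omega>" "fst p \<noteq> snd p"
          using elim disj[of "fst p"] by auto
        then have "?k \<le> frac_kernel s (fst p) (snd p)"
          using R s by (intro frac_kernel_ge) auto
        then show ?thesis
          using nn by (auto simp: ennreal_mult[symmetric] ac_simps intro!: ennreal_leI mult_left_mono)
      qed auto
    qed
  qed
  finally show ?thesis .
qed

section \<open>Sign-changing solutions\<close>

text \<open>If the integral is infinite, both sides have the default value 0.\<close>

lemma set_integral_eq_nn_integral:
  fixes f :: "'a \<Rightarrow> real"
  assumes [measurable]: "f \<in> borel_measurable M" "A \<in> sets M" and "\<And>x. 0 \<le> f x"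
  shows "(\<integral>x\<in>A. f x \<partial>M) = enn2real (\<integral>\<^sup>+ x\<in>A. ennreal (f x) \<partial>M)"
proof -
  have "(\<integral>x\<in>A. f x \<partial>M) = enn2real (\<integral>\<^sup>+ x. ennreal (indicator A x *\<^sub>R f x) \<partial>M)"
    unfolding set_lebesgue_integral_def
    by (rule integral_eq_nn_integral) (use assms(3) in auto)
  also have "(\<integral>\<^sup>+ x. ennreal (indicator A x *\<^sub>R f x) \<partial>M) = (\<integral>\<^sup>+ x\<in>A. ennreal (f x) \<partial>M)"
    by (intro nn_integral_cong) (auto simp: indicator_def)
  finally show ?thesis .
qed

lemma ennreal_enn2real_le: "ennreal (enn2real y) \<le> y"
  by (cases y) auto

lemma D_s2_0_uminus:
  assumes "u \<in> D_s2_0 s \<Omega>"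
  shows "(\<lambda>x. - u x) \<in> D_s2_0 s \<Omega>"
proof -
  obtain \<phi> where \<phi>: "\<And>k. \<phi> k \<in> test_funs \<Omega>"
    "(\<lambda>k. gagliardo_sq s (\<lambda>x. \<phi> k x - u x)) \<longlonglongrightarrow> 0"
    "(\<lambda>k. \<integral>\<^sup>+ x. ennreal ((\<phi> k x - u x)\<^sup>2) \<partial>lebesgue) \<longlonglongrightarrow> 0"
    using assms by (auto simp: D_s2_0_def)
  have "gagliardo_sq s (\<lambda>x. - \<phi> k x - - u x) = gagliardo_sq s (\<lambda>x. \<phi> k x - u x)" for k
    unfolding gagliardo_sq_def by (intro nn_integral_cong) (simp add: power2_eq_square algebra_simps)
  moreover have "(- \<phi> k x - - u x)\<^sup>2 = (\<phi> k x - u x)\<^sup>2" for k x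
    by (simp add: power2_eq_square algebra_simps)
  moreover have "(\<lambda>x. - \<phi> k x) \<in> test_funs \<Omega>" for k
    using test_funs_mult_const[OF \<phi>(1), of "-1"] by simp
  ultimately show ?thesis
    unfolding D_s2_0_def using \<phi>(2,3) D_s2_0_measurable[OF assms]
    by (auto intro!: exI[of _ "\<lambda>k x. - \<phi> k x"])
qed

section \<open>Power estimates and ball volumes\<close>

lemma abs_powr_mult_square: "\<bar>a\<bar> powr (q - 2) * a * a = \<bar>a\<bar> powr q" for a q :: real
proof (cases "a = 0")
  case False
  have "\<bar>a\<bar> powr q = \<bar>a\<bar> powr (q - 2 + 2)" by simp
  also have "\<dots> = \<bar>a\<bar> powr (q - 2) * \<bar>a\<bar> powr 2"
    by (rule powr_add)
  also have "\<bar>a\<bar> powr 2 = a * a"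
    using False by (simp add: power2_eq_square)
  finally show ?thesis by simp
qed simp

text \<open>Below the threshold \<open>T\<close> the positive exponent q - 1 gives the linear term,
  above it the negative exponent q - 2 gives the quadratic one. A large \<open>T\<close> makes the
  quadratic coefficient small.\<close>

lemma powr_le_linear_plus_square:
  fixes t T q :: real
  assumes "0 \<le> t" "0 < T" "1 < q" "q < 2"
  shows "t powr q \<le> T powr (q - 1) * t + T powr (q - 2) * t\<^sup>2"
proof (cases "t \<le> T")
  case True
  have "t powr q = t powr (q - 1) * t"
    using assms powr_mult_base[of t "q - 1"] by (simp add: mult.commute)
  also have "\<dots> \<le> T powr (q - 1) * t"
    using assms True by (intro mult_right_mono powr_mono2) auto
  finally show ?thesis
    by (simp add: add_increasing2)
next
  case False
  have "t powr q = t powr (q - 2) * t\<^sup>2"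
    using abs_powr_mult_square[of t q] assms by (simp add: power2_eq_square)
  also have "\<dots> \<le> T powr (q - 2) * t\<^sup>2"
    using assms False by (intro mult_right_mono powr_mono2') auto
  finally show ?thesis
    using assms by (simp add: add_increasing)
qed

text \<open>Split at 2 \<tau>: below it the linear term suffices, above it w <= 2 (w - \<tau>),
  whence the factor 4. The quadratic term lives on w > \<tau> only, a set of small measure when the
  mass of \<open>w\<close> is small.\<close>

lemma powr_le_linear_plus_truncated_square:
  fixes w \<tau> q :: real
  assumes "0 \<le> w" "0 < \<tau>" "1 < q" "q < 2"
  shows "w powr q \<le> (2 * \<tau>) powr (q - 1) * w + 4 * (2 * \<tau>) powr (q - 2) * (max 0 (w - \<tau>))\<^sup>2"
proof (cases "w \<le> 2 * \<tau>")
  case True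
  have "w powr q = w powr (q - 1) * w"
    using assms powr_mult_base[of w "q - 1"] by (simp add: mult.commute)
  also have "\<dots> \<le> (2 * \<tau>) powr (q - 1) * w"
    using assms True by (intro mult_right_mono powr_mono2) auto
  finally show ?thesis
    by (simp add: add_increasing2)
next
  case False
  have "w powr q = w powr (q - 2) * w\<^sup>2"
    using abs_powr_mult_square[of w q] assms by (simp add: power2_eq_square)
  also have "\<dots> \<le> (2 * \<tau>) powr (q - 2) * (2 * max 0 (w - \<tau>))\<^sup>2"
    using assms False by (intro mult_mono powr_mono2' power_mono) auto
  finally show ?thesis
    using assms by (simp add: add_increasing power_mult_distrib)
qed

lemma measure_ball_eq:
  "0 \<le> R \<Longrightarrow> measure lebesgue (ball (0::'a::euclidean_space) R) = unit_ball_vol (real DIM('a)) * R ^ DIM('a)"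
  by (simp add: content_ball)

lemma ex_ball_volume_ge:
  obtains R where "0 < R" "m \<le> measure lebesgue (ball (0::'a::euclidean_space) R)"
proof -
  define V where "V = unit_ball_vol (real DIM('a))"
  have V: "0 < V" by (simp add: V_def)
  \<comment> \<open>The maximum with 1 ensures that R is at most its n-th power.\<close>
  define R where "R = max 1 (m / V)"
  have "m = V * (m / V)" using V by simp
  also have "\<dots> \<le> V * R ^ 1"
    using V by (intro mult_left_mono) (auto simp: R_def)
  also have "\<dots> \<le> V * R ^ DIM('a)"
    using V by (intro mult_left_mono power_increasing) (auto simp: R_def Suc_leI)
  also have "\<dots> = measure lebesgue (ball (0::'a) R)"
    by (subst measure_ball_eq) (auto simp: V_def R_def)
  finally show ?thesis
    by (intro that[of R]) (auto simp: R_def)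
qed

text \<open>The powers of \<open>R\<close> combine to \<open>V / 2 * R powr (- 2 * s)\<close>, which
  tends to infinity as \<open>R\<close> tends to 0. The radius is the one for which this equals
  \<open>K\<close>.\<close>

lemma ex_poincare_constant_ge:
  assumes "0 < s" "0 < K"
  obtains R where "0 < R"
    "K \<le> measure lebesgue (ball (0::'a::euclidean_space) R) / 2 * R powr - (real DIM('a) + 2 * s)"
proof -
  define V where "V = unit_ball_vol (real DIM('a))"
  have V: "0 < V" by (simp add: V_def)
  define R where "R = (2 * K / V) powr (- 1 / (2 * s))"
  have R: "0 < R" using V assms by (simp add: R_def)
  have "measure lebesgue (ball (0::'a) R) / 2 * R powr - (real DIM('a) + 2 * s) =
    V / 2 * (R powr (real DIM('a)) * R powr - (real DIM('a) + 2 * s))"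
    using R by (subst measure_ball_eq) (auto simp: V_def powr_realpow)
  also have "\<dots> = V / 2 * R powr (- 2 * s)"
    unfolding powr_add[symmetric] by simp
  also have "R powr (- 2 * s) = 2 * K / V"
    using assms V by (simp add: R_def powr_powr)
  also have "V / 2 * (2 * K / V) = K"
    using V by simp
  finally show ?thesis
    using R by (intro that) auto
qed

section \<open>Energy, gap and negative part of eigenfunctions\<close>

context sublinear_domain
begin

text \<open>The lower bound of the kernel on pairs of distinct points of \<Omega>. The added 1 keeps
  the base positive if the diameter is 0.\<close>

definition kappa :: real where
  "kappa = (1 + diameter \<Omega>) powr - (real DIM('a) + 2 * s)"

definition eigenfunction :: "real \<Rightarrow> ('a \<Rightarrow> real) \<Rightarrow> bool" where
  "eigenfunction lam v \<longleftrightarrow> 0 < lam \<and> v \<in> D_s2_0 s \<Omega> \<and> Lq_norm q \<Omega> v = 1 \<and>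
     weak_solution s \<Omega> (\<lambda>\<phi>. \<integral>x\<in>\<Omega>. lam * \<bar>v x\<bar> powr (q - 2) * v x * \<phi> x \<partial>lebesgue) (\<lambda>_. 0) v"

definition pos_mass :: "('a \<Rightarrow> real) \<Rightarrow> ennreal" where
  "pos_mass v = (\<integral>\<^sup>+ x. ennreal (max 0 (v x)) \<partial>lebesgue)"

definition neg_mass :: "('a \<Rightarrow> real) \<Rightarrow> ennreal" where
  "neg_mass v = (\<integral>\<^sup>+ x. ennreal (max 0 (- v x)) \<partial>lebesgue)"

lemma kappa_pos: "0 < kappa"
  using diameter_ge_0[OF bounded_domain] by (simp add: kappa_def)

lemma eigenfunction_test:
  "eigenfunction lam v \<Longrightarrow> \<phi> \<in> D_s2_0 s \<Omega> \<Longrightarrow>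
    frac_form s v \<phi> = (\<integral>x\<in>\<Omega>. lam * \<bar>v x\<bar> powr (q - 2) * v x * \<phi> x \<partial>lebesgue)"
  by (simp add: eigenfunction_def weak_solution_def)

lemma eigenfunction_measurable: "eigenfunction lam v \<Longrightarrow> v \<in> borel_measurable lebesgue"
  unfolding eigenfunction_def using D_s2_0_measurable by blast

lemma eigenfunction_Lq:
  "eigenfunction lam v \<Longrightarrow> (\<integral>\<^sup>+ x\<in>\<Omega>. ennreal (\<bar>v x\<bar> powr q) \<partial>lebesgue) = 1"
  using q_gt by (intro Lq_norm_eq_1D) (auto simp: eigenfunction_def)

lemma eigenfunction_outside:
  "eigenfunction lam v \<Longrightarrow> AE x in lebesgue. x \<notin> \<Omega> \<longrightarrow> v x = 0"
  by (rule D_s2_0_outside) (auto simp: eigenfunction_def)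

text \<open>Since the Bochner integral of a non-integrable function is 0, a nonzero value of the
  form already entails finite energy.\<close>

lemma eigenfunction_energy:
  assumes "eigenfunction lam v"
  shows "gagliardo_sq s v = ennreal lam"
proof -
  have [measurable]: "v \<in> borel_measurable lebesgue"
    by (rule eigenfunction_measurable[OF assms])
  have lam: "0 < lam" and v: "v \<in> D_s2_0 s \<Omega>"
    using assms by (auto simp: eigenfunction_def)
  have "enn2real (gagliardo_sq s v) = (\<integral>x\<in>\<Omega>. lam * \<bar>v x\<bar> powr q \<partial>lebesgue)"
  proof -
    have "lam * \<bar>v x\<bar> powr (q - 2) * v x * v x = lam * \<bar>v x\<bar> powr q" for x
      using abs_powr_mult_square[of "v x" q] by (simp only: mult.assoc)
    then show ?thesis
      using eigenfunction_test[OF assms v] frac_form_self[OF \<open>v \<in> borel_measurable lebesgue\<close>, of s]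
      by (simp only:)
  qed
  also have "\<dots> = enn2real (\<integral>\<^sup>+ x\<in>\<Omega>. ennreal (lam * \<bar>v x\<bar> powr q) \<partial>lebesgue)"
    using lam by (intro set_integral_eq_nn_integral) auto
  also have "(\<integral>\<^sup>+ x\<in>\<Omega>. ennreal (lam * \<bar>v x\<bar> powr q) \<partial>lebesgue) = ennreal lam"
    using lam eigenfunction_Lq[OF assms] by (simp add: ennreal_mult mult.assoc nn_integral_cmult)
  finally have "enn2real (gagliardo_sq s v) = lam"
    using lam by simp
  with lam show ?thesis
    by (cases "gagliardo_sq s v") auto
qed

text \<open>The equation is odd in \<open>v\<close>. This reduces everything to the case where the
  positive mass is the large one.\<close>

lemma eigenfunction_uminus:
  assumes "eigenfunction lam v"
  shows "eigenfunction lam (\<lambda>x. - v x)"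
proof -
  have "frac_form s (\<lambda>x. - v x) \<phi> = - frac_form s v \<phi>" for \<phi>
    unfolding frac_form_def by (subst Bochner_Integration.integral_minus[symmetric])
      (intro Bochner_Integration.integral_cong refl, simp add: algebra_simps)
  moreover have "(\<integral>x\<in>\<Omega>. lam * \<bar>- v x\<bar> powr (q - 2) * - v x * \<phi> x \<partial>lebesgue) =
      - (\<integral>x\<in>\<Omega>. lam * \<bar>v x\<bar> powr (q - 2) * v x * \<phi> x \<partial>lebesgue)" for \<phi>
    by (simp add: set_lebesgue_integral_def)
  ultimately show ?thesis
    using assms eigenfunction_test[OF assms] D_s2_0_uminus[of v]
    by (simp add: eigenfunction_def weak_solution_def Lq_norm_def)
qed

lemma pos_mass_uminus: "pos_mass (\<lambda>x. - v x) = neg_mass v"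
  by (simp add: pos_mass_def neg_mass_def)

lemma mass_product_le:
  assumes "v \<in> D_s2_0 s \<Omega>"
  shows "ennreal kappa * (pos_mass v * neg_mass v) \<le>
    (\<integral>\<^sup>+ p. ennreal (max 0 (v (fst p)) * max 0 (- v (snd p)) * frac_kernel s (fst p) (snd p)) \<partial>lebesgue2)"
  unfolding kappa_def pos_mass_def neg_mass_def
proof (rule nn_integral_kernel_product_ge)
  have [measurable]: "v \<in> borel_measurable lebesgue"
    by (rule D_s2_0_measurable[OF assms])
  show "AE x in lebesgue. x \<notin> \<Omega> \<longrightarrow> max 0 (v x) = 0 \<and> max 0 (- v x) = 0"
    using D_s2_0_outside[OF assms domain_measurable] by eventually_elim auto
  show "dist x y \<le> 1 + diameter \<Omega>" if "x \<in> \<Omega>" "y \<in> \<Omega>" for x y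
    using diameter_bounded_bound[OF bounded_domain that] by simp
qed (use D_s2_0_measurable[OF assms] s_pos in \<open>auto simp: max_def\<close>)

text \<open>Passing to |v| preserves admissibility and norm, so \<Lambda> bounds E(|v|) from below.
  The energy lost sits on pairs of opposite sign, and the kernel bound measures it by the product of
  the masses.\<close>

lemma eigenfunction_gap:
  assumes "eigenfunction lam v"
  shows "ennreal (Lambda_q s q \<Omega>) + ennreal kappa * (pos_mass v * neg_mass v) \<le> ennreal lam"
proof -
  have [measurable]: "v \<in> borel_measurable lebesgue"
    by (rule eigenfunction_measurable[OF assms])
  have v: "v \<in> D_s2_0 s \<Omega>" "gagliardo_sq s v < \<infinity>"
    using assms eigenfunction_energy[OF assms] by (auto simp: eigenfunction_def)
  let ?k = "\<lambda>p. frac_kernel s (fst p) (snd p)"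
  have "gagliardo_sq s (\<lambda>x. \<bar>v x\<bar>) \<le> gagliardo_sq s v"
    by (rule gagliardo_lipschitz) (rule abs_triangle_ineq3)
  then have "ennreal (Lambda_q s q \<Omega>) \<le> gagliardo_sq s (\<lambda>x. \<bar>v x\<bar>)"
    using v(2) assms by (intro Lambda_q_le D_s2_0_abs v) (auto simp: eigenfunction_def Lq_norm_def)
  then have "ennreal (Lambda_q s q \<Omega>) + ennreal kappa * (pos_mass v * neg_mass v) \<le>
    gagliardo_sq s (\<lambda>x. \<bar>v x\<bar>) + (\<integral>\<^sup>+ p. ennreal (max 0 (v (fst p)) * max 0 (- v (snd p)) * ?k p) \<partial>lebesgue2)"
    by (rule add_mono[OF _ mass_product_le[OF v(1)]])
  also have "\<dots> = (\<integral>\<^sup>+ p. ennreal ((\<bar>v (fst p)\<bar> - \<bar>v (snd p)\<bar>)\<^sup>2 * ?k p) +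
     ennreal (max 0 (v (fst p)) * max 0 (- v (snd p)) * ?k p) \<partial>lebesgue2)"
    unfolding gagliardo_sq_def by (rule nn_integral_add[symmetric]) auto
  also have "\<dots> \<le> gagliardo_sq s v"
    unfolding gagliardo_sq_def
  proof (rule nn_integral_mono)
    fix p
    \<comment> \<open>For a > 0 > b the two squares differ by 4 a |b|, of which one quarter is
      kept.\<close>
    have "(\<bar>a\<bar> - \<bar>b\<bar>)\<^sup>2 + max 0 a * max 0 (- b) \<le> (a - b)\<^sup>2" for a b :: real
    proof (cases "0 < a \<and> b < 0")
      case True
      then have "(a - b)\<^sup>2 - ((\<bar>a\<bar> - \<bar>b\<bar>)\<^sup>2 + max 0 a * max 0 (- b)) = 3 * (a * - b)"
        by (simp add: power2_eq_square algebra_simps)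
      moreover have "0 \<le> a * - b"
        using True by (intro mult_nonneg_nonneg) auto
      ultimately show ?thesis by linarith
    next
      case False
      then have "max 0 a * max 0 (- b) = 0" by auto
      moreover have "(\<bar>a\<bar> - \<bar>b\<bar>)\<^sup>2 \<le> (a - b)\<^sup>2"
        by (simp add: abs_le_square_iff[symmetric] abs_triangle_ineq3)
      ultimately show ?thesis by (simp only: add_0_right)
    qed
    from mult_right_mono[OF this[of "v (fst p)" "v (snd p)"] frac_kernel_nonneg[of s "fst p" "snd p"]]
    show "ennreal ((\<bar>v (fst p)\<bar> - \<bar>v (snd p)\<bar>)\<^sup>2 * ?k p) +
        ennreal (max 0 (v (fst p)) * max 0 (- v (snd p)) * ?k p) \<le> ennreal ((v (fst p) - v (snd p))\<^sup>2 * ?k p)"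
      by (simp add: ennreal_plus[symmetric] ennreal_leI frac_kernel_nonneg distrib_right del: ennreal_plus)
  qed
  finally show ?thesis
    by (simp add: eigenfunction_energy[OF assms])
qed

text \<open>The equation is tested with the negative part w. Minus the form dominates E(w) plus an
  interaction of w with the positive part, so negative values are penalised by the positive mass; on
  the right v = -w wherever w is nonzero.\<close>

lemma eigenfunction_neg_part:
  assumes "eigenfunction lam v"
  shows "gagliardo_sq s (\<lambda>x. max 0 (- v x)) + ennreal kappa * (pos_mass v * neg_mass v) \<le>
    ennreal lam * (\<integral>\<^sup>+ x. ennreal (max 0 (- v x) powr q) \<partial>lebesgue)"
proof -
  have [measurable]: "v \<in> borel_measurable lebesgue"
    by (rule eigenfunction_measurable[OF assms])
  have v: "v \<in> D_s2_0 s \<Omega>" "gagliardo_sq s v < \<infinity>" and lam: "0 < lam"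
    using assms eigenfunction_energy[OF assms] by (auto simp: eigenfunction_def)
  define w where "w = (\<lambda>x. max 0 (- v x))"
  have w: "w \<in> D_s2_0 s \<Omega>" "gagliardo_sq s w < \<infinity>"
    unfolding w_def by (rule D_s2_0_neg_part[OF v])+
  have [measurable]: "w \<in> borel_measurable lebesgue"
    by (simp add: w_def)
  let ?k = "\<lambda>p. frac_kernel s (fst p) (snd p)"
  let ?g = "\<lambda>p. (v (fst p) - v (snd p)) * (w (fst p) - w (snd p)) * ?k p"
  \<comment> \<open>Expanding -(v(x) - v(y)) (w(x) - w(y)) gives (w(x) - w(y))^2 and the cross terms
    of the positive part at one point with w at the other. One of the two cross terms is
    kept.\<close>
  have pw: "(w (fst p) - w (snd p))\<^sup>2 * ?k p + max 0 (v (fst p)) * w (snd p) * ?k p \<le> - ?g p" for p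
  proof -
    have "(max 0 (- a) - max 0 (- b))\<^sup>2 + max 0 a * max 0 (- b) \<le> - ((a - b) * (max 0 (- a) - max 0 (- b)))" for a b :: real
    proof -
      consider "0 \<le> a" "0 \<le> b" | "0 \<le> a" "b \<le> 0" | "a \<le> 0" "0 \<le> b" | "a \<le> 0" "b \<le> 0" by linarith
      then show ?thesis
      proof cases
        case 3
        then have "0 \<le> - a * b" by (simp add: mult_nonpos_nonneg)
        with 3 show ?thesis by (simp add: power2_eq_square algebra_simps)
      qed (auto simp: max_def power2_eq_square algebra_simps)
    qed
    from mult_right_mono[OF this[of "v (fst p)" "v (snd p)"] frac_kernel_nonneg[of s "fst p" "snd p"]]
    show ?thesis by (simp add: w_def algebra_simps)
  qed
  have "gagliardo_sq s w + ennreal kappa * (pos_mass v * neg_mass v) \<le>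
    gagliardo_sq s w + (\<integral>\<^sup>+ p. ennreal (max 0 (v (fst p)) * w (snd p) * ?k p) \<partial>lebesgue2)"
    unfolding w_def by (intro add_left_mono mass_product_le v)
  also have "\<dots> = (\<integral>\<^sup>+ p. ennreal ((w (fst p) - w (snd p))\<^sup>2 * ?k p) +
      ennreal (max 0 (v (fst p)) * w (snd p) * ?k p) \<partial>lebesgue2)"
    unfolding gagliardo_sq_def by (rule nn_integral_add[symmetric]) auto
  also have "\<dots> \<le> (\<integral>\<^sup>+ p. ennreal (- ?g p) \<partial>lebesgue2)"
    using pw by (intro nn_integral_mono)
      (simp add: ennreal_plus[symmetric] ennreal_leI frac_kernel_nonneg w_def del: ennreal_plus)
  also have "\<dots> = ennreal (\<integral> p. - ?g p \<partial>lebesgue2)"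
  proof (rule nn_integral_eq_integral)
    show "integrable lebesgue2 (\<lambda>p. - ?g p)"
      using frac_form_integrable[OF _ _ v(2) w(2)] by simp
    have "0 \<le> - ?g p" for p
      by (rule order_trans[OF _ pw]) (simp add: frac_kernel_nonneg w_def)
    then show "AE p in lebesgue2. 0 \<le> - ?g p" by simp
  qed
  also have "(\<integral> p. - ?g p \<partial>lebesgue2) = - frac_form s v w"
    by (simp add: frac_form_def)
  also have "frac_form s v w = (\<integral>x\<in>\<Omega>. lam * \<bar>v x\<bar> powr (q - 2) * v x * w x \<partial>lebesgue)"
    by (rule eigenfunction_test[OF assms w(1)])
  also have "- \<dots> = (\<integral>x\<in>\<Omega>. lam * w x powr q \<partial>lebesgue)"
  proof -
    have "lam * \<bar>v x\<bar> powr (q - 2) * v x * w x = - (lam * w x powr q)" for x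
      using abs_powr_mult_square[of "v x" q] by (cases "v x < 0") (auto simp: w_def max_def)
    then show ?thesis
      unfolding set_lebesgue_integral_def
      by (simp only: scaleR_minus_right Bochner_Integration.integral_minus minus_minus)
  qed
  also have "\<dots> = enn2real (\<integral>\<^sup>+ x\<in>\<Omega>. ennreal (lam * w x powr q) \<partial>lebesgue)"
    using lam by (intro set_integral_eq_nn_integral) auto
  also have "ennreal \<dots> \<le> (\<integral>\<^sup>+ x\<in>\<Omega>. ennreal (lam * w x powr q) \<partial>lebesgue)"
    by (rule ennreal_enn2real_le)
  also have "\<dots> \<le> (\<integral>\<^sup>+ x. ennreal lam * ennreal (w x powr q) \<partial>lebesgue)"
    using lam by (intro nn_integral_mono) (auto simp: indicator_def ennreal_mult)
  also have "\<dots> = ennreal lam * (\<integral>\<^sup>+ x. ennreal (w x powr q) \<partial>lebesgue)"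
    by (rule nn_integral_cmult) simp
  finally show ?thesis
    by (simp add: w_def)
qed

section \<open>Uniform mass bound and vanishing of a small negative part\<close>

lemma domain_poincare:
  obtains C where "0 < C"
    "\<And>f. f \<in> borel_measurable lebesgue \<Longrightarrow> (AE x in lebesgue. x \<notin> \<Omega> \<longrightarrow> f x = 0) \<Longrightarrow>
      ennreal C * (\<integral>\<^sup>+ x. ennreal ((f x)\<^sup>2) \<partial>lebesgue) \<le> gagliardo_sq s f"
proof -
  \<comment> \<open>The summand 1 makes \<open>m\<close> positive; hence the volume of the ball and
    the resulting constant are positive.\<close>
  define m where "m = 1 + measure lebesgue \<Omega>"
  have m: "0 < m" "emeasure lebesgue \<Omega> \<le> ennreal m"
    using domain_finite by (auto simp: m_def emeasure_eq_ennreal_measure less_top[symmetric] add_pos_nonneg intro!: ennreal_leI simp del: emeasure_completion)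
  obtain R where R: "0 < R" "2 * m \<le> measure lebesgue (ball (0::'a) R)"
    by (rule ex_ball_volume_ge)
  show ?thesis
  proof (rule that)
    show "0 < measure lebesgue (ball (0::'a) R) / 2 * R powr - (real DIM('a) + 2 * s)"
      using R m by simp
  qed (rule gagliardo_poincare[OF _ domain_measurable _ s_pos less_imp_le[OF m(1)] m(2) R(2)])
qed

lemma mass_add:
  assumes [measurable]: "v \<in> borel_measurable lebesgue"
  shows "pos_mass v + neg_mass v = (\<integral>\<^sup>+ x. ennreal \<bar>v x\<bar> \<partial>lebesgue)"
proof -
  have "pos_mass v + neg_mass v = (\<integral>\<^sup>+ x. ennreal (max 0 (v x)) + ennreal (max 0 (- v x)) \<partial>lebesgue)"
    unfolding pos_mass_def neg_mass_def by (rule nn_integral_add[symmetric]) auto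
  also have "\<dots> = (\<integral>\<^sup>+ x. ennreal \<bar>v x\<bar> \<partial>lebesgue)"
    by (intro nn_integral_cong) (auto simp: max_def)
  finally show ?thesis .
qed

text \<open>Combines |t| <= 1 + t^2 with the finite measure of \<Omega>. Finite masses are what
  later permits cancellation in \<open>ennreal\<close>.\<close>

lemma eigenfunction_L1_finite:
  assumes "eigenfunction lam v"
  shows "(\<integral>\<^sup>+ x. ennreal \<bar>v x\<bar> \<partial>lebesgue) < \<infinity>"
proof -
  have [measurable]: "v \<in> borel_measurable lebesgue"
    by (rule eigenfunction_measurable[OF assms])
  have "(\<integral>\<^sup>+ x. ennreal \<bar>v x\<bar> \<partial>lebesgue) \<le> (\<integral>\<^sup>+ x. indicator \<Omega> x + ennreal ((v x)\<^sup>2) \<partial>lebesgue)"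
  proof (rule nn_integral_mono_AE)
    show "AE x in lebesgue. ennreal \<bar>v x\<bar> \<le> indicator \<Omega> x + ennreal ((v x)\<^sup>2)"
      using eigenfunction_outside[OF assms]
    proof eventually_elim
      case (elim x)
      have "\<bar>v x\<bar> \<le> 1 + (v x)\<^sup>2"
        using sum_squares_bound[of 1 "\<bar>v x\<bar>"] abs_ge_zero[of "v x"] unfolding power2_abs by simp
      then have "ennreal \<bar>v x\<bar> \<le> 1 + ennreal ((v x)\<^sup>2)"
        by (simp add: ennreal_1[symmetric] ennreal_plus[symmetric] ennreal_leI del: ennreal_1 ennreal_plus)
      with elim show ?case by (auto simp: indicator_def)
    qed
  qed
  also have "\<dots> = emeasure lebesgue \<Omega> + (\<integral>\<^sup>+ x. ennreal ((v x)\<^sup>2) \<partial>lebesgue)"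
    by (subst nn_integral_add) auto
  also have "\<dots> < \<infinity>"
    using domain_finite D_s2_0_L2[of v s \<Omega>] assms by (auto simp: eigenfunction_def)
  finally show ?thesis .
qed

text \<open>The Poincare inequality bounds the integral of v^2 by L / C. Splitting |v|^q at a large
  threshold, the quadratic term then carries at most half of the unit norm and the linear term
  carries the rest. The bound is uniform in \<open>v\<close>, which stands in for
  compactness.\<close>

lemma eigenfunction_mass_ge:
  assumes "0 < L"
  obtains c where "0 < c" "\<And>lam v. eigenfunction lam v \<Longrightarrow> lam \<le> L \<Longrightarrow> ennreal c \<le> pos_mass v + neg_mass v"
proof -
  obtain C where C: "0 < C" "\<And>f. f \<in> borel_measurable lebesgue \<Longrightarrow> (AE x in lebesgue. x \<notin> \<Omega> \<longrightarrow> f x = 0) \<Longrightarrow>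
      ennreal C * (\<integral>\<^sup>+ x. ennreal ((f x)\<^sup>2) \<partial>lebesgue) \<le> gagliardo_sq s f"
    using domain_poincare by blast
  \<comment> \<open>Solves \<open>T powr (q - 2) * L = C / 2\<close>, so that the quadratic term
    contributes at most 1 / 2.\<close>
  define T where "T = (2 * L / C) powr (1 / (2 - q))"
  have T: "0 < T" using C assms by (simp add: T_def)
  have "T powr (q - 2) = (2 * L / C) powr (1 / (2 - q) * (q - 2))"
    by (simp add: T_def powr_powr)
  also have "1 / (2 - q) * (q - 2) = -1"
    using q_less by (simp add: field_simps)
  finally have Tq: "T powr (q - 2) * L = C / 2"
    using C(1) assms by (simp add: powr_minus field_simps)
  define c where "c = 1 / (2 * T powr (q - 1))"
  show ?thesis
  proof (rule that)
    show "0 < c" using T by (simp add: c_def)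
    fix lam v assume v: "eigenfunction lam v" and lam: "lam \<le> L"
    have [measurable]: "v \<in> borel_measurable lebesgue"
      by (rule eigenfunction_measurable[OF v])
    let ?I1 = "\<integral>\<^sup>+ x. ennreal \<bar>v x\<bar> \<partial>lebesgue" and ?I2 = "\<integral>\<^sup>+ x. ennreal ((v x)\<^sup>2) \<partial>lebesgue"
    obtain a b where ab: "?I1 = ennreal a" "0 \<le> a" "?I2 = ennreal b" "0 \<le> b"
      using eigenfunction_L1_finite[OF v] D_s2_0_L2[of v s \<Omega>] v
      by (cases ?I1; cases ?I2) (auto simp: eigenfunction_def)
    have "ennreal (C * b) \<le> ennreal lam"
      using C(2)[OF _ eigenfunction_outside[OF v]] C(1) ab by (simp add: eigenfunction_energy[OF v] ennreal_mult)
    then have Cb: "C * b \<le> L"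
      using v lam by (simp add: eigenfunction_def)
    have "1 \<le> (\<integral>\<^sup>+ x. ennreal (T powr (q - 1)) * ennreal \<bar>v x\<bar> + ennreal (T powr (q - 2)) * ennreal ((v x)\<^sup>2) \<partial>lebesgue)"
      unfolding eigenfunction_Lq[OF v, symmetric]
    proof (rule nn_integral_mono)
      fix x
      show "ennreal (\<bar>v x\<bar> powr q) * indicator \<Omega> x
         \<le> ennreal (T powr (q - 1)) * ennreal \<bar>v x\<bar> + ennreal (T powr (q - 2)) * ennreal ((v x)\<^sup>2)"
        using powr_le_linear_plus_square[of "\<bar>v x\<bar>" T q] T q_gt q_less
        by (auto simp: indicator_def ennreal_mult[symmetric] ennreal_plus[symmetric] ennreal_leI simp del: ennreal_plus)
    qed
    also have "\<dots> = ennreal (T powr (q - 1)) * ?I1 + ennreal (T powr (q - 2)) * ?I2"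
      by (simp add: nn_integral_add nn_integral_cmult)
    also have "\<dots> = ennreal (T powr (q - 1) * a + T powr (q - 2) * b)"
      using ab by (simp add: ennreal_mult[symmetric])
    finally have "ennreal 1 \<le> ennreal (T powr (q - 1) * a + T powr (q - 2) * b)"
      by simp
    then have "1 \<le> T powr (q - 1) * a + T powr (q - 2) * b"
      using ab by (subst (asm) ennreal_le_iff) auto
    moreover have "T powr (q - 2) * b \<le> 1 / 2"
    proof -
      have "T powr (q - 2) * b * C \<le> T powr (q - 2) * L"
        using mult_left_mono[OF Cb, of "T powr (q - 2)"] by (simp add: ac_simps)
      then show ?thesis
        unfolding Tq using C(1) by (simp add: field_simps)
    qed
    ultimately have "1 / 2 \<le> T powr (q - 1) * a" by linarith
    then have "c \<le> a"
      using T by (simp add: c_def field_simps)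
    then show "ennreal c \<le> pos_mass v + neg_mass v"
      unfolding mass_add[OF \<open>v \<in> borel_measurable lebesgue\<close>] ab(1) by (rule ennreal_leI)
  qed
qed

text \<open>Absorption: the linear part of lam w^q is swallowed by the interaction with the positive
  mass, the quadratic part by E(w) through the Poincare inequality on a small support. The threshold
  is the same for all \<open>lam\<close> and \<open>v\<close>, as it is built from
  \<open>c0\<close>, \<open>L\<close> and the fixed data.\<close>

lemma eigenfunction_neg_mass_eq_0:
  assumes "0 < c0" "0 < L"
  obtains \<eta> where "0 < \<eta>" "\<And>lam v. eigenfunction lam v \<Longrightarrow> lam \<le> L \<Longrightarrow>
    ennreal c0 \<le> ennreal kappa * pos_mass v \<Longrightarrow> neg_mass v \<le> ennreal \<eta> \<Longrightarrow> neg_mass v = 0"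
proof -
  obtain C where C: "0 < C" "\<And>f. f \<in> borel_measurable lebesgue \<Longrightarrow> (AE x in lebesgue. x \<notin> \<Omega> \<longrightarrow> f x = 0) \<Longrightarrow>
      ennreal C * (\<integral>\<^sup>+ x. ennreal ((f x)\<^sup>2) \<partial>lebesgue) \<le> gagliardo_sq s f"
    using domain_poincare by blast
  \<comment> \<open>Makes the linear coefficient at most \<open>c0\<close>, the lower bound for the
    coefficient of the interaction.\<close>
  define \<tau> where "\<tau> = (c0 / L) powr (1 / (q - 1)) / 2"
  have \<tau>: "0 < \<tau>" "L * (2 * \<tau>) powr (q - 1) = c0"
    using assms q_gt by (auto simp: \<tau>_def powr_powr)
  define K where "K = L * (4 * (2 * \<tau>) powr (q - 2))"
  have K: "0 < K" using assms \<tau> by (simp add: K_def)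
  \<comment> \<open>A Poincare constant of at least 2 K makes the quadratic term at most E(w) /
    2.\<close>
  obtain R where R: "0 < R" "2 * K \<le> measure lebesgue (ball (0::'a) R) / 2 * R powr - (real DIM('a) + 2 * s)"
    using ex_poincare_constant_ge[OF s_pos, of "2 * K"] K by auto
  define m where "m = measure lebesgue (ball (0::'a) R) / 2"
  have m: "0 < m" using R(1) by (simp add: m_def)
  show ?thesis
  proof (rule that)
    \<comment> \<open>The witness \<tau> m comes from Markov's inequality: a negative mass of at
      most \<tau> m confines w > \<tau> to a set of measure at most \<open>m\<close>, half of the
      volume of the ball.\<close>
    show "0 < \<tau> * m" using \<tau> m by simp
    fix lam v assume v: "eigenfunction lam v" and lam: "lam \<le> L"
      and P: "ennreal c0 \<le> ennreal kappa * pos_mass v" and N: "neg_mass v \<le> ennreal (\<tau> * m)"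
    have lam0: "0 < lam" and vD: "v \<in> D_s2_0 s \<Omega>" "gagliardo_sq s v < \<infinity>"
      using v eigenfunction_energy[OF v] by (auto simp: eigenfunction_def)
    have [measurable]: "v \<in> borel_measurable lebesgue"
      by (rule eigenfunction_measurable[OF v])
    define w where "w = (\<lambda>x. max 0 (- v x))"
    define g where "g = (\<lambda>x. max 0 (w x - \<tau>))"
    have [measurable]: "w \<in> borel_measurable lebesgue" "g \<in> borel_measurable lebesgue"
      by (auto simp: w_def g_def)
    have Nw: "neg_mass v = (\<integral>\<^sup>+ x. ennreal (w x) \<partial>lebesgue)"
      by (simp add: neg_mass_def w_def)
    have wE: "gagliardo_sq s w < \<infinity>"
      unfolding w_def by (rule D_s2_0_neg_part[OF vD])
    let ?G = "\<integral>\<^sup>+ x. ennreal ((g x)\<^sup>2) \<partial>lebesgue"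
    have "gagliardo_sq s w + ennreal kappa * (pos_mass v * neg_mass v) \<le>
        ennreal lam * (\<integral>\<^sup>+ x. ennreal (w x powr q) \<partial>lebesgue)"
      unfolding w_def by (rule eigenfunction_neg_part[OF v])
    also have "\<dots> = (\<integral>\<^sup>+ x. ennreal lam * ennreal (w x powr q) \<partial>lebesgue)"
      by (rule nn_integral_cmult[symmetric]) simp
    also have "\<dots> \<le> (\<integral>\<^sup>+ x. ennreal c0 * ennreal (w x) + ennreal K * ennreal ((g x)\<^sup>2) \<partial>lebesgue)"
    proof (rule nn_integral_mono)
      fix x
      have "lam * w x powr q \<le> L * w x powr q"
        using lam by (rule mult_right_mono) simp
      also have "\<dots> \<le> L * ((2 * \<tau>) powr (q - 1) * w x + 4 * (2 * \<tau>) powr (q - 2) * (g x)\<^sup>2)"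
        using powr_le_linear_plus_truncated_square[of "w x" \<tau> q] \<tau>(1) q_gt q_less assms(2)
        by (intro mult_left_mono) (auto simp: g_def w_def)
      also have "\<dots> = c0 * w x + K * (g x)\<^sup>2"
        unfolding K_def \<tau>(2)[symmetric] by (simp add: algebra_simps)
      finally show "ennreal lam * ennreal (w x powr q) \<le> ennreal c0 * ennreal (w x) + ennreal K * ennreal ((g x)\<^sup>2)"
        using lam0 assms(1) K by (simp add: ennreal_mult[symmetric] ennreal_plus[symmetric] ennreal_leI w_def del: ennreal_plus)
    qed
    also have "\<dots> = ennreal c0 * neg_mass v + ennreal K * ?G"
      unfolding Nw by (simp add: nn_integral_add nn_integral_cmult)
    also have "\<dots> \<le> ennreal kappa * (pos_mass v * neg_mass v) + ennreal K * ?G"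
      using mult_right_mono[OF P, of "neg_mass v"] by (intro add_right_mono) (simp add: mult.assoc)
    finally have "gagliardo_sq s w + ennreal kappa * (pos_mass v * neg_mass v) \<le>
        ennreal K * ?G + ennreal kappa * (pos_mass v * neg_mass v)"
      by (simp add: add.commute)
    \<comment> \<open>A common summand in \<open>ennreal\<close> can be cancelled only if it is
      finite.\<close>
    moreover have "ennreal kappa * (pos_mass v * neg_mass v) \<noteq> \<infinity>"
    proof -
      have "pos_mass v + neg_mass v \<noteq> \<infinity>"
        using eigenfunction_L1_finite[OF v] mass_add[of v] by simp
      then show ?thesis
        by (simp add: ennreal_mult_eq_top_iff)
    qed
    ultimately have 1: "gagliardo_sq s w \<le> ennreal K * ?G"
      by (simp add: ennreal_add_left_cancel_le add.commute)
    let ?A = "{x. \<tau> < w x}"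
    have A: "?A \<in> sets lebesgue"
      using borel_measurable_less[of "\<lambda>_. \<tau>" lebesgue w] by simp
    have "emeasure lebesgue ?A \<le> emeasure lebesgue {x \<in> space lebesgue. 1 \<le> ennreal (1 / \<tau>) * ennreal (w x)}"
    proof (rule emeasure_mono)
      show "{x \<in> space lebesgue. 1 \<le> ennreal (1 / \<tau>) * ennreal (w x)} \<in> sets lebesgue"
        by measurable
      have "1 \<le> ennreal (1 / \<tau>) * ennreal t" if "\<tau> < t" for t
        using that \<tau>(1) by (simp add: ennreal_mult[symmetric] flip: ennreal_1)
      then show "?A \<subseteq> {x \<in> space lebesgue. 1 \<le> ennreal (1 / \<tau>) * ennreal (w x)}"
        by auto
    qed
    also have "\<dots> \<le> ennreal (1 / \<tau>) * (\<integral>\<^sup>+ x\<in>space lebesgue. ennreal (w x) \<partial>lebesgue)"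
      by (rule nn_integral_Markov_inequality) auto
    also have "\<dots> = ennreal (1 / \<tau>) * neg_mass v"
      by (simp add: Nw)
    also have "\<dots> \<le> ennreal (1 / \<tau>) * ennreal (\<tau> * m)"
      using N by (rule mult_left_mono) simp
    also have "\<dots> = ennreal m"
      using \<tau> m by (simp add: ennreal_mult[symmetric])
    finally have mA: "emeasure lebesgue ?A \<le> ennreal m" .
    have "ennreal (2 * K) * ?G \<le>
        ennreal (measure lebesgue (ball (0::'a) R) / 2 * R powr - (real DIM('a) + 2 * s)) * ?G"
      using R(2) by (intro mult_right_mono ennreal_leI) auto
    also have "\<dots> \<le> gagliardo_sq s g"
      by (rule gagliardo_poincare[OF _ A _ s_pos less_imp_le[OF m] mA]) (auto simp: g_def m_def)
    also have "\<dots> \<le> gagliardo_sq s w"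
      by (rule gagliardo_lipschitz) (auto simp: g_def)
    finally have 2: "ennreal (2 * K) * ?G \<le> gagliardo_sq s w" .
    have "gagliardo_sq s w = 0"
    proof -
      obtain e where e: "gagliardo_sq s w = ennreal e" "0 \<le> e"
        using wE by (cases "gagliardo_sq s w") auto
      have "2 * gagliardo_sq s w \<le> 2 * (ennreal K * ?G)"
        by (rule mult_left_mono[OF 1]) simp
      also have "\<dots> = ennreal (2 * K) * ?G"
        using K by (simp add: ennreal_mult mult.assoc)
      also note 2
      finally have "ennreal (2 * e) \<le> ennreal e"
        using e by (simp add: ennreal_mult)
      then show ?thesis
        using e by simp
    qed
    moreover have "AE x in lebesgue. x \<notin> \<Omega> \<longrightarrow> w x = 0"
      using eigenfunction_outside[OF v] by eventually_elim (auto simp: w_def)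
    ultimately have "ennreal C * (\<integral>\<^sup>+ x. ennreal ((w x)\<^sup>2) \<partial>lebesgue) = 0"
      using C(2)[of w] by simp
    then have "(\<integral>\<^sup>+ x. ennreal ((w x)\<^sup>2) \<partial>lebesgue) = 0"
      using C(1) by simp
    then have "AE x in lebesgue. ennreal ((w x)\<^sup>2) = 0"
      by (subst (asm) nn_integral_0_iff_AE) auto
    then have "AE x in lebesgue. ennreal (w x) = 0"
      by eventually_elim simp
    then show "neg_mass v = 0"
      unfolding Nw by (subst nn_integral_0_iff_AE) auto
  qed
qed

end

section \<open>Nonnegative solutions\<close>

text \<open>Discrete Picone identity, applied with a = v(x) + e, b = v(y) + e, c = \<psi>(x) and d =
  \<psi>(y). The shift drops out of a - b.\<close>

lemma picone_identity:
  fixes a b c d :: real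
  assumes "0 < a" "0 < b"
  shows "(c - d)\<^sup>2 = (a - b) * (c\<^sup>2 / a - d\<^sup>2 / b) + (b * c - a * d)\<^sup>2 / (a * b)"
  using assms by (simp add: field_simps power2_eq_square)

text \<open>The remainder at a pair where v is 0 at the first point and \<open>b\<close> at the
  second: for a shift e tending to 0 it behaves like b c^2 k / e.\<close>

lemma picone_remainder_at_top:
  fixes b c d k :: real
  assumes "0 < b" "c \<noteq> 0" "0 < k"
  shows "filterlim (\<lambda>n. ((b + inverse (real (Suc n))) * c - inverse (real (Suc n)) * d)\<^sup>2 /
    (inverse (real (Suc n)) * (b + inverse (real (Suc n)))) * k) at_top sequentially"
proof -
  let ?e = "\<lambda>n. inverse (real (Suc n))"
  have "(\<lambda>n. ((b + ?e n) * c - ?e n * d)\<^sup>2 / (b + ?e n) * k) \<longlonglongrightarrow> ((b + 0) * c - 0 * d)\<^sup>2 / (b + 0) * k"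
    using assms by (intro tendsto_intros LIMSEQ_inverse_real_of_nat) auto
  moreover have "0 < ((b + 0) * c - 0 * d)\<^sup>2 / (b + 0) * k"
    using assms by simp
  moreover have "filterlim (\<lambda>n. real (Suc n)) at_top sequentially"
    using filterlim_compose[OF filterlim_real_sequentially filterlim_Suc] .
  ultimately have "filterlim (\<lambda>n. ((b + ?e n) * c - ?e n * d)\<^sup>2 / (b + ?e n) * k * real (Suc n)) at_top sequentially"
    by (rule filterlim_tendsto_pos_mult_at_top)
  moreover have "X / (inverse y * z) * k = X / z * k * y" for X y z :: real
    by (simp add: divide_inverse)
  ultimately show ?thesis
    by simp
qed

context sublinear_domain
begin

text \<open>The Picone identity is integrated and its product term evaluated by testing the equation
  with the quotient. Both nonnegative terms are retained: the remainder yields positivity of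
  \<open>v\<close>, the other one the comparison of \<open>lam\<close> with E(\<psi>).\<close>

lemma picone_inequality:
  assumes v: "eigenfunction lam v" and nonneg: "AE x in lebesgue. 0 \<le> v x"
    and \<psi>: "\<psi> \<in> test_funs \<Omega>" "gagliardo_sq s \<psi> < \<infinity>" and e: "0 < e"
  shows "(\<integral>\<^sup>+ p. ennreal (((v (snd p) + e) * \<psi> (fst p) - (v (fst p) + e) * \<psi> (snd p))\<^sup>2 /
        ((v (fst p) + e) * (v (snd p) + e)) * frac_kernel s (fst p) (snd p)) \<partial>lebesgue2) +
      (\<integral>\<^sup>+ x\<in>\<Omega>. ennreal (lam * (\<bar>v x\<bar> powr (q - 1) * ((\<psi> x)\<^sup>2 / (\<bar>v x\<bar> + e)))) \<partial>lebesgue)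
    \<le> gagliardo_sq s \<psi>" (is "?S + ?A \<le> _")
proof -
  let ?k = "\<lambda>p. frac_kernel s (fst p) (snd p)"
  have [measurable]: "v \<in> borel_measurable lebesgue" "\<psi> \<in> borel_measurable lebesgue"
    using eigenfunction_measurable[OF v] test_funs_measurable[OF \<psi>(1)] by auto
  have vD: "v \<in> D_s2_0 s \<Omega>" "gagliardo_sq s v < \<infinity>" and lam: "0 < lam"
    using v eigenfunction_energy[OF v] by (auto simp: eigenfunction_def)
  define h where "h = (\<lambda>x. (\<psi> x)\<^sup>2 / (\<bar>v x\<bar> + e))"
  have [measurable]: "h \<in> borel_measurable lebesgue"
    by (simp add: h_def)
  have h0: "0 \<le> h x" for x
    using e by (simp add: h_def)
  have h: "h \<in> D_s2_0 s \<Omega>" "gagliardo_sq s h < \<infinity>"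
    unfolding h_def by (rule D_s2_0_square_div[OF vD \<psi> e])+
  let ?r = "\<lambda>p. ((v (snd p) + e) * \<psi> (fst p) - (v (fst p) + e) * \<psi> (snd p))\<^sup>2 /
        ((v (fst p) + e) * (v (snd p) + e)) * ?k p"
  let ?r' = "\<lambda>p. (\<psi> (fst p) - \<psi> (snd p)) * (\<psi> (fst p) - \<psi> (snd p)) * ?k p -
     (v (fst p) - v (snd p)) * (h (fst p) - h (snd p)) * ?k p"
  \<comment> \<open>This holds only a.e., because the remainder contains \<open>v\<close> while
    \<open>h\<close> contains its modulus.\<close>
  have eq: "AE p in lebesgue2. 0 \<le> ?r' p \<and> ?r p = ?r' p"
    using AE_lebesgue2[OF nonneg]
  proof eventually_elim
    case (elim p)
    then have pos: "0 < v (fst p) + e" "0 < v (snd p) + e"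
      using e by auto
    have "(v (fst p) + e) - (v (snd p) + e) = v (fst p) - v (snd p)" by simp
    moreover have "h (fst p) = (\<psi> (fst p))\<^sup>2 / (v (fst p) + e)" "h (snd p) = (\<psi> (snd p))\<^sup>2 / (v (snd p) + e)"
      using elim by (simp_all add: h_def)
    ultimately have "(\<psi> (fst p) - \<psi> (snd p))\<^sup>2 - (v (fst p) - v (snd p)) * (h (fst p) - h (snd p)) =
      ((v (snd p) + e) * \<psi> (fst p) - (v (fst p) + e) * \<psi> (snd p))\<^sup>2 / ((v (fst p) + e) * (v (snd p) + e))"
      using picone_identity[OF pos, of "\<psi> (fst p)" "\<psi> (snd p)"] by simp
    then have "?r' p = ?r p"
      by (simp add: power2_eq_square[of "\<psi> (fst p) - \<psi> (snd p)"] left_diff_distrib[symmetric])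
    moreover have "0 \<le> ?r p"
      using pos by (intro mult_nonneg_nonneg divide_nonneg_nonneg frac_kernel_nonneg) auto
    ultimately show ?case by simp
  qed
  have int: "integrable lebesgue2 ?r'"
    using \<psi> vD h by (intro Bochner_Integration.integrable_diff frac_form_integrable) auto
  have "?S = (\<integral>\<^sup>+ p. ennreal (?r' p) \<partial>lebesgue2)"
    by (intro nn_integral_cong_AE) (use eq in eventually_elim, simp)
  also have "\<dots> = ennreal (\<integral> p. ?r' p \<partial>lebesgue2)"
    by (intro nn_integral_eq_integral int) (use eq in eventually_elim, simp)
  also have "(\<integral> p. ?r' p \<partial>lebesgue2) = frac_form s \<psi> \<psi> - frac_form s v h"
    unfolding frac_form_def
    by (intro Bochner_Integration.integral_diff frac_form_integrable) (use \<psi> vD h in auto)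
  finally have S: "?S = ennreal (frac_form s \<psi> \<psi> - frac_form s v h)" .
  have "frac_form s v h = (\<integral>x\<in>\<Omega>. lam * \<bar>v x\<bar> powr (q - 2) * v x * h x \<partial>lebesgue)"
    by (rule eigenfunction_test[OF v h(1)])
  also have "\<dots> = (\<integral>x\<in>\<Omega>. lam * (\<bar>v x\<bar> powr (q - 1) * h x) \<partial>lebesgue)"
    unfolding set_lebesgue_integral_def
  proof (intro integral_cong_AE)
    show "AE x in lebesgue. indicator \<Omega> x *\<^sub>R (lam * \<bar>v x\<bar> powr (q - 2) * v x * h x) =
      indicator \<Omega> x *\<^sub>R (lam * (\<bar>v x\<bar> powr (q - 1) * h x))"
      using nonneg
    proof eventually_elim
      case (elim x)
      then have "\<bar>v x\<bar> powr (q - 2) * v x = \<bar>v x\<bar> powr (q - 1)"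
        using powr_mult_base[of "v x" "q - 2"] by (simp add: mult.commute)
      then have "lam * \<bar>v x\<bar> powr (q - 2) * v x * h x = lam * (\<bar>v x\<bar> powr (q - 1) * h x)"
        by (simp only: mult.assoc[symmetric]) (simp only: mult.assoc)
      then show ?case by (simp only:)
    qed
  qed auto
  also have "\<dots> = enn2real ?A"
  proof -
    have "0 \<le> lam * (\<bar>v x\<bar> powr (q - 1) * h x)" for x
      using lam h0 by simp
    then have "(\<integral>x\<in>\<Omega>. lam * (\<bar>v x\<bar> powr (q - 1) * h x) \<partial>lebesgue) =
      enn2real (\<integral>\<^sup>+ x\<in>\<Omega>. ennreal (lam * (\<bar>v x\<bar> powr (q - 1) * h x)) \<partial>lebesgue)"
      by (intro set_integral_eq_nn_integral) auto
    then show ?thesis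
      by (simp only: h_def)
  qed
  finally have form: "frac_form s v h = enn2real ?A" .
  \<comment> \<open>Finiteness of \<open>?A\<close> has to be shown separately, since
    \<open>enn2real\<close> would turn an infinite value into 0.\<close>
  obtain M where M: "0 < M" "\<And>x. \<bar>\<psi> x\<bar> \<le> M"
    using test_funs_bounded[OF \<psi>(1)] by blast
  define B where "B = lam * (M\<^sup>2 * (1 + 1 / e))"
  have "?A \<le> (\<integral>\<^sup>+ x\<in>\<Omega>. ennreal B \<partial>lebesgue)"
  proof (intro nn_integral_mono mult_right_mono ennreal_leI)
    fix x
    have "\<bar>v x\<bar> powr (q - 1) \<le> 1 + \<bar>v x\<bar>"
    proof (cases "\<bar>v x\<bar> \<le> 1")
      case True
      then have "\<bar>v x\<bar> powr (q - 1) \<le> 1 powr (q - 1)"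
        using q_gt by (intro powr_mono2) auto
      then show ?thesis by simp
    next
      case False
      then have "\<bar>v x\<bar> powr (q - 1) \<le> \<bar>v x\<bar> powr 1"
        using q_less by (intro powr_mono) auto
      then show ?thesis by simp
    qed
    also have "\<dots> \<le> (1 + 1 / e) * (\<bar>v x\<bar> + e)"
      using e by (simp add: field_simps)
    finally have "\<bar>v x\<bar> powr (q - 1) / (\<bar>v x\<bar> + e) \<le> 1 + 1 / e"
      using e by (simp add: pos_divide_le_eq add_nonneg_pos)
    moreover have "(\<psi> x)\<^sup>2 \<le> M\<^sup>2"
      using power_mono[OF M(2)[of x], of 2] by simp
    ultimately have "(\<psi> x)\<^sup>2 * (\<bar>v x\<bar> powr (q - 1) / (\<bar>v x\<bar> + e)) \<le> M\<^sup>2 * (1 + 1 / e)"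
      using e by (intro mult_mono) auto
    then show "lam * (\<bar>v x\<bar> powr (q - 1) * ((\<psi> x)\<^sup>2 / (\<bar>v x\<bar> + e))) \<le> B"
      unfolding B_def using lam by (intro mult_left_mono) (auto simp: mult.commute)
  qed auto
  also have "\<dots> = ennreal B * emeasure lebesgue \<Omega>"
    by (rule nn_integral_cmult_indicator) simp
  also have "\<dots> < \<infinity>"
    using domain_finite by (simp add: ennreal_mult_less_top)
  finally have A: "?A = ennreal (frac_form s v h)"
    unfolding form by simp
  have "0 \<le> frac_form s v h"
    unfolding form by simp
  moreover have "0 \<le> frac_form s \<psi> \<psi> - frac_form s v h"
  proof -
    have "0 \<le> (\<integral> p. ?r' p \<partial>lebesgue2)"
      by (intro integral_nonneg_AE) (use eq in eventually_elim, simp)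
    then show ?thesis
      using \<open>(\<integral> p. ?r' p \<partial>lebesgue2) = frac_form s \<psi> \<psi> - frac_form s v h\<close> by simp
  qed
  ultimately have "?S + ?A = ennreal (frac_form s \<psi> \<psi>)"
    unfolding S A by (subst ennreal_plus[symmetric]) auto
  then show ?thesis
    using gagliardo_frac_form[OF _ \<psi>(2)] by simp
qed

text \<open>A strong maximum principle from nonlocality. The remainder blows up on pairs with v = 0
  and \<psi> nonzero at the first point and v > 0 at the second, while its integral stays below
  E(\<psi>). By Fatou these pairs form a null set, and since \<open>v\<close> does not vanish a.e.
  the first factor is null.\<close>

lemma nonneg_eigenfunction_pos:
  assumes v: "eigenfunction lam v" and nonneg: "AE x in lebesgue. 0 \<le> v x"
    and \<psi>: "\<psi> \<in> test_funs \<Omega>" "gagliardo_sq s \<psi> < \<infinity>"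
  shows "AE x in lebesgue. \<psi> x \<noteq> 0 \<longrightarrow> 0 < v x"
proof -
  let ?k = "\<lambda>p. frac_kernel s (fst p) (snd p)"
  let ?e = "\<lambda>n. inverse (real (Suc n))"
  have [measurable]: "v \<in> borel_measurable lebesgue" "\<psi> \<in> borel_measurable lebesgue"
    using eigenfunction_measurable[OF v] test_funs_measurable[OF \<psi>(1)] by auto
  let ?r = "\<lambda>n p. ennreal (((v (snd p) + ?e n) * \<psi> (fst p) - (v (fst p) + ?e n) * \<psi> (snd p))\<^sup>2 /
        ((v (fst p) + ?e n) * (v (snd p) + ?e n)) * ?k p)"
  define P where "P = {x \<in> space lebesgue. v x = 0 \<and> \<psi> x \<noteq> 0}"
  define Q where "Q = {x \<in> space lebesgue. 0 < v x}"
  have PQ [measurable]: "P \<in> sets lebesgue" "Q \<in> sets lebesgue"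
    unfolding P_def Q_def by measurable
  have le: "(\<integral>\<^sup>+ p. ?r n p \<partial>lebesgue2) \<le> gagliardo_sq s \<psi>" for n
    by (rule order_trans[OF _ picone_inequality[OF v nonneg \<psi>, of "?e n"]]) auto
  \<comment> \<open>A finite upper bound for \<infinity> times the measure of
    \<open>P \<times> Q\<close> forces this measure to be 0.\<close>
  have "\<infinity> * emeasure lebesgue2 (P \<times> Q) = (\<integral>\<^sup>+ p. \<infinity> * indicator (P \<times> Q) p \<partial>lebesgue2)"
    by (rule nn_integral_cmult_indicator[symmetric]) simp
  also have "\<dots> \<le> (\<integral>\<^sup>+ p. liminf (\<lambda>n. ?r n p) \<partial>lebesgue2)"
  proof (rule nn_integral_mono)
    fix p
    show "\<infinity> * indicator (P \<times> Q) p \<le> liminf (\<lambda>n. ?r n p)"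
    proof (cases "p \<in> P \<times> Q")
      case True
      then have p: "v (fst p) = 0" "\<psi> (fst p) \<noteq> 0" "0 < v (snd p)"
        by (auto simp: P_def Q_def)
      then have "0 < ?k p"
        by (intro frac_kernel_pos) auto
      from picone_remainder_at_top[OF p(3,2) this, of "\<psi> (snd p)"]
      have "(\<lambda>n. ?r n p) \<longlonglongrightarrow> top"
        unfolding ennreal_tendsto_top_eq_at_top p(1) add_0_left .
      then have "liminf (\<lambda>n. ?r n p) = top"
        by (rule lim_imp_Liminf[OF trivial_limit_sequentially])
      then show ?thesis by simp
    qed simp
  qed
  also have "\<dots> \<le> liminf (\<lambda>n. \<integral>\<^sup>+ p. ?r n p \<partial>lebesgue2)"
    by (rule nn_integral_liminf) measurable
  also have "\<dots> \<le> liminf (\<lambda>n. gagliardo_sq s \<psi>)"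
    by (rule Liminf_mono[OF always_eventually[OF allI]]) (rule le)
  also have "\<dots> < \<infinity>"
    using \<psi>(2) by (simp add: Liminf_const)
  finally have "emeasure lebesgue2 (P \<times> Q) = 0"
    by (auto simp: ennreal_mult_less_top)
  then have "emeasure lebesgue P * emeasure lebesgue Q = 0"
    by (simp add: lebesgue.emeasure_pair_measure_Times)
  moreover have "emeasure lebesgue Q \<noteq> 0"
  proof
    assume "emeasure lebesgue Q = 0"
    then have "AE x in lebesgue. x \<notin> Q"
      using PQ(2) by (intro AE_not_in) (simp add: null_sets_def)
    with nonneg have "AE x in lebesgue. ennreal (\<bar>v x\<bar> powr q) * indicator \<Omega> x = 0"
      by eventually_elim (auto simp: Q_def not_less)
    then have "(\<integral>\<^sup>+ x\<in>\<Omega>. ennreal (\<bar>v x\<bar> powr q) \<partial>lebesgue) = 0"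
      by (subst nn_integral_0_iff_AE) auto
    then show False
      using eigenfunction_Lq[OF v] by simp
  qed
  ultimately have "emeasure lebesgue P = 0"
    by (auto simp: mult_eq_0_iff)
  then have "AE x in lebesgue. x \<notin> P"
    using PQ(1) by (intro AE_not_in) (simp add: null_sets_def)
  with nonneg show ?thesis
    by eventually_elim (auto simp: P_def less_le)
qed

text \<open>Letting the shift tend to 0 in the Picone inequality gives lam \<open>?J\<close> <=
  E(\<psi>) by Fatou; positivity of \<open>v\<close> where \<psi> is nonzero identifies the
  pointwise limit. Since \<open>v\<close> and \<psi> have the same norm, \<open>?J\<close> is at
  least 1.\<close>

lemma nonneg_eigenfunction_le_gagliardo:
  assumes v: "eigenfunction lam v" and nonneg: "AE x in lebesgue. 0 \<le> v x"
    and \<psi>: "\<psi> \<in> test_funs \<Omega>" "gagliardo_sq s \<psi> < \<infinity>" "Lq_norm q \<Omega> \<psi> = 1"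
  shows "ennreal lam \<le> gagliardo_sq s \<psi>"
proof -
  let ?e = "\<lambda>n. inverse (real (Suc n))"
  have [measurable]: "v \<in> borel_measurable lebesgue" "\<psi> \<in> borel_measurable lebesgue"
    using eigenfunction_measurable[OF v] test_funs_measurable[OF \<psi>(1)] by auto
  have lam: "0 < lam" using v by (simp add: eigenfunction_def)
  note pos = nonneg_eigenfunction_pos[OF v nonneg \<psi>(1,2)]
  let ?J = "\<integral>\<^sup>+ x\<in>\<Omega>. ennreal (\<bar>v x\<bar> powr (q - 2) * (\<psi> x)\<^sup>2) \<partial>lebesgue"
  let ?a = "\<lambda>n x. ennreal (lam * (\<bar>v x\<bar> powr (q - 1) * ((\<psi> x)\<^sup>2 / (\<bar>v x\<bar> + ?e n)))) * indicator \<Omega> x"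
  have le: "(\<integral>\<^sup>+ x. ?a n x \<partial>lebesgue) \<le> gagliardo_sq s \<psi>" for n
    by (rule order_trans[OF _ picone_inequality[OF v nonneg \<psi>(1,2), of "?e n"]]) auto
  have "ennreal lam * ?J = (\<integral>\<^sup>+ x. ennreal lam * (ennreal (\<bar>v x\<bar> powr (q - 2) * (\<psi> x)\<^sup>2) * indicator \<Omega> x) \<partial>lebesgue)"
    by (rule nn_integral_cmult[symmetric]) simp
  also have "\<dots> \<le> (\<integral>\<^sup>+ x. liminf (\<lambda>n. ?a n x) \<partial>lebesgue)"
  proof (rule nn_integral_mono_AE)
    show "AE x in lebesgue. ennreal lam * (ennreal (\<bar>v x\<bar> powr (q - 2) * (\<psi> x)\<^sup>2) * indicator \<Omega> x)
        \<le> liminf (\<lambda>n. ?a n x)"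
      using pos
    proof eventually_elim
      case (elim x)
      show ?case
      proof (cases "\<psi> x = 0 \<or> x \<notin> \<Omega>")
        case False
        then have vx: "0 < v x" and x: "x \<in> \<Omega>"
          using elim by auto
        have "(\<lambda>n. lam * (\<bar>v x\<bar> powr (q - 1) * ((\<psi> x)\<^sup>2 / (\<bar>v x\<bar> + ?e n)))) \<longlonglongrightarrow>
          lam * (\<bar>v x\<bar> powr (q - 1) * ((\<psi> x)\<^sup>2 / (\<bar>v x\<bar> + 0)))"
          using vx by (intro tendsto_intros LIMSEQ_inverse_real_of_nat) auto
        moreover have "\<bar>v x\<bar> powr (q - 1) * ((\<psi> x)\<^sup>2 / (\<bar>v x\<bar> + 0)) = \<bar>v x\<bar> powr (q - 2) * (\<psi> x)\<^sup>2"
          using vx powr_mult_base[of "v x" "q - 2"] by (simp add: field_simps)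
        ultimately have "(\<lambda>n. ?a n x) \<longlonglongrightarrow> ennreal (lam * (\<bar>v x\<bar> powr (q - 2) * (\<psi> x)\<^sup>2))"
          using tendsto_ennrealI x by (simp only: indicator_simps mult_1_right)
        then have "liminf (\<lambda>n. ?a n x) = ennreal (lam * (\<bar>v x\<bar> powr (q - 2) * (\<psi> x)\<^sup>2))"
          by (rule lim_imp_Liminf[OF trivial_limit_sequentially])
        then show ?thesis
          using x lam by (simp add: ennreal_mult)
      qed auto
    qed
  qed
  also have "\<dots> \<le> liminf (\<lambda>n. \<integral>\<^sup>+ x. ?a n x \<partial>lebesgue)"
    by (rule nn_integral_liminf) measurable
  also have "\<dots> \<le> liminf (\<lambda>n. gagliardo_sq s \<psi>)"
    by (rule Liminf_mono[OF always_eventually[OF allI]]) (rule le)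
  also have "\<dots> = gagliardo_sq s \<psi>"
    by (simp add: Liminf_const)
  finally have lamJ: "ennreal lam * ?J \<le> gagliardo_sq s \<psi>" .
  have "1 \<le> ?J"
  proof -
    have "1 = (\<integral>\<^sup>+ x\<in>\<Omega>. ennreal (\<bar>\<psi> x\<bar> powr q) \<partial>lebesgue)"
      using Lq_norm_eq_1D[OF \<psi>(3)] q_gt by simp
    also have "\<dots> \<le> (\<integral>\<^sup>+ x. ennreal (q / 2) * (ennreal (\<bar>v x\<bar> powr (q - 2) * (\<psi> x)\<^sup>2) * indicator \<Omega> x) +
        ennreal (1 - q / 2) * (ennreal (\<bar>v x\<bar> powr q) * indicator \<Omega> x) \<partial>lebesgue)"
    proof (rule nn_integral_mono_AE)
      show "AE x in lebesgue. ennreal (\<bar>\<psi> x\<bar> powr q) * indicator \<Omega> x \<le>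
        ennreal (q / 2) * (ennreal (\<bar>v x\<bar> powr (q - 2) * (\<psi> x)\<^sup>2) * indicator \<Omega> x) +
        ennreal (1 - q / 2) * (ennreal (\<bar>v x\<bar> powr q) * indicator \<Omega> x)"
        using pos
      proof eventually_elim
        case (elim x)
        show ?case
        proof (cases "\<psi> x = 0 \<or> x \<notin> \<Omega>")
          case False
          then have vx: "0 < \<bar>v x\<bar>" and \<psi>x: "0 < \<bar>\<psi> x\<bar>" and x: "x \<in> \<Omega>"
            using elim by auto
          \<comment> \<open>Weighted AM-GM with weights q / 2 and 1 - q / 2: the powers of |v|
            cancel and |\<psi>|^q remains.\<close>
          let ?X = "\<bar>v x\<bar> powr (q - 2) * \<bar>\<psi> x\<bar> powr 2" and ?Y = "\<bar>v x\<bar> powr q"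
          have "?X powr (q / 2) * ?Y powr (1 - q / 2) \<le> q / 2 * ?X + (1 - q / 2) * ?Y"
            using vx \<psi>x q_gt q_less by (intro Youngs_inequality_0) auto
          moreover have "?X powr (q / 2) * ?Y powr (1 - q / 2) =
              \<bar>v x\<bar> powr ((q - 2) * (q / 2) + q * (1 - q / 2)) * \<bar>\<psi> x\<bar> powr q"
            using vx \<psi>x by (simp add: powr_mult powr_powr powr_add del: powr_numeral)
          moreover have "(q - 2) * (q / 2) + q * (1 - q / 2) = 0"
            by (simp add: field_simps)
          ultimately have "\<bar>\<psi> x\<bar> powr q \<le> q / 2 * (\<bar>v x\<bar> powr (q - 2) * (\<psi> x)\<^sup>2) + (1 - q / 2) * \<bar>v x\<bar> powr q"
            using vx \<psi>x by simp
          then show ?thesis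
            using x q_gt q_less
            by (simp add: ennreal_mult[symmetric] ennreal_plus[symmetric] ennreal_leI del: ennreal_plus)
        qed auto
      qed
    qed
    also have "\<dots> = ennreal (q / 2) * ?J + ennreal (1 - q / 2) * (\<integral>\<^sup>+ x\<in>\<Omega>. ennreal (\<bar>v x\<bar> powr q) \<partial>lebesgue)"
      by (simp add: nn_integral_add nn_integral_cmult)
    finally have J: "1 \<le> ennreal (q / 2) * ?J + ennreal (1 - q / 2)"
      using eigenfunction_Lq[OF v] by simp
    show "1 \<le> ?J"
    proof (cases ?J)
      case (real j)
      have "ennreal 1 \<le> ennreal (q / 2 * j + (1 - q / 2))"
        using J real q_gt q_less by (simp add: ennreal_mult[symmetric] ennreal_plus[symmetric] del: ennreal_plus)
      then have "1 \<le> q / 2 * j + (1 - q / 2)"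
        using real q_gt q_less by (subst (asm) ennreal_le_iff) auto
      then have "q / 2 * 1 \<le> q / 2 * j" by simp
      then have "1 \<le> j"
        using q_gt by (subst (asm) mult_le_cancel_left_pos) auto
      then show ?thesis
        using real by (simp add: ennreal_leI flip: ennreal_1)
    qed simp
  qed
  from mult_left_mono[OF this, of "ennreal lam"] lamJ show ?thesis
    by simp
qed

section \<open>Finiteness of the infimum and isolation of \<Lambda>\<close>

lemma ex_test_fun_finite:
  assumes v: "eigenfunction lam v"
  obtains \<psi> where "\<psi> \<in> test_funs \<Omega>" "Lq_norm q \<Omega> \<psi> = 1" "gagliardo_sq s \<psi> < \<infinity>"
proof -
  have vD: "v \<in> D_s2_0 s \<Omega>" "gagliardo_sq s v < \<infinity>"
    using v eigenfunction_energy[OF v] by (auto simp: eigenfunction_def)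
  obtain \<phi> where \<phi>: "\<And>k. \<phi> k \<in> test_funs \<Omega>"
    "(\<lambda>k. gagliardo_sq s (\<lambda>x. \<phi> k x - v x)) \<longlonglongrightarrow> 0"
    "(\<lambda>k. \<integral>\<^sup>+ x. ennreal ((\<phi> k x - v x)\<^sup>2) \<partial>lebesgue) \<longlonglongrightarrow> 0"
    using vD(1) by (auto simp: D_s2_0_def)
  have [measurable]: "v \<in> borel_measurable lebesgue" "\<phi> k \<in> borel_measurable lebesgue" for k
    using eigenfunction_measurable[OF v] test_funs_measurable[OF \<phi>(1)] by auto
  from tendsto_0_imp_eventually_finite[OF \<phi>(2)] obtain m where
    m: "\<And>k. m \<le> k \<Longrightarrow> gagliardo_sq s (\<lambda>x. \<phi> k x - v x) < \<infinity>"
    by (auto simp: eventually_sequentially)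
  \<comment> \<open>Otherwise all late approximants vanish a.e. and their L2 limit \<open>v\<close>
    is 0, against its normalisation.\<close>
  have "\<exists>k\<ge>m. Lq_norm q \<Omega> (\<phi> k) \<noteq> 0"
  proof (rule ccontr)
    assume *: "\<not> ?thesis"
    have "(\<integral>\<^sup>+ x. ennreal ((\<phi> k x - v x)\<^sup>2) \<partial>lebesgue) = (\<integral>\<^sup>+ x. ennreal ((v x)\<^sup>2) \<partial>lebesgue)" if "m \<le> k" for k
    proof (rule nn_integral_cong_AE)
      have "(\<integral>\<^sup>+ x\<in>\<Omega>. ennreal (\<bar>\<phi> k x\<bar> powr q) \<partial>lebesgue) = 0"
        using * that test_funs_Lq_finite[OF \<phi>(1)[of k]] by (auto simp: Lq_norm_def enn2real_eq_0_iff)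
      then have "AE x in lebesgue. ennreal (\<bar>\<phi> k x\<bar> powr q) * indicator \<Omega> x = 0"
        by (subst (asm) nn_integral_0_iff_AE) auto
      then show "AE x in lebesgue. ennreal ((\<phi> k x - v x)\<^sup>2) = ennreal ((v x)\<^sup>2)"
      proof eventually_elim
        case (elim x)
        then have "\<phi> k x = 0"
          using test_funs_outside[OF \<phi>(1), of x k]
          by (cases "x \<in> \<Omega>") (auto simp: ennreal_eq_0_iff not_less powr_eq_0_iff dest: order.antisym[OF _ powr_ge_zero])
        then show ?case by simp
      qed
    qed
    then have "eventually (\<lambda>k. (\<integral>\<^sup>+ x. ennreal ((\<phi> k x - v x)\<^sup>2) \<partial>lebesgue) = (\<integral>\<^sup>+ x. ennreal ((v x)\<^sup>2) \<partial>lebesgue)) sequentially"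
      by (auto simp: eventually_sequentially)
    then have "(\<lambda>k. \<integral>\<^sup>+ x. ennreal ((\<phi> k x - v x)\<^sup>2) \<partial>lebesgue) \<longlonglongrightarrow> (\<integral>\<^sup>+ x. ennreal ((v x)\<^sup>2) \<partial>lebesgue)"
      by (rule tendsto_eventually)
    then have "(\<integral>\<^sup>+ x. ennreal ((v x)\<^sup>2) \<partial>lebesgue) = 0"
      by (rule LIMSEQ_unique[OF _ \<phi>(3)])
    then have "AE x in lebesgue. ennreal ((v x)\<^sup>2) = 0"
      by (subst (asm) nn_integral_0_iff_AE) auto
    then have "AE x in lebesgue. ennreal (\<bar>v x\<bar> powr q) * indicator \<Omega> x = 0"
      by eventually_elim simp
    then have "(\<integral>\<^sup>+ x\<in>\<Omega>. ennreal (\<bar>v x\<bar> powr q) \<partial>lebesgue) = 0"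
      by (subst nn_integral_0_iff_AE) auto
    then show False
      using eigenfunction_Lq[OF v] by simp
  qed
  then obtain k where k: "m \<le> k" "Lq_norm q \<Omega> (\<phi> k) \<noteq> 0" by blast
  define N where "N = Lq_norm q \<Omega> (\<phi> k)"
  have N: "0 < N"
    using k(2) by (simp add: N_def Lq_norm_def less_le)
  have "gagliardo_sq s (\<phi> k) \<le> ennreal (1 + 1) * gagliardo_sq s v + ennreal (1 + 1 / 1) * gagliardo_sq s (\<lambda>x. \<phi> k x - v x)"
    by (rule gagliardo_triangle) auto
  also have "\<dots> < \<infinity>"
    using vD(2) m[OF k(1)] by (simp add: ennreal_mult_less_top)
  finally have "gagliardo_sq s (\<lambda>x. 1 / N * \<phi> k x) < \<infinity>"
    by (subst gagliardo_cmult) (auto simp: ennreal_mult_less_top)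
  moreover have "Lq_norm q \<Omega> (\<lambda>x. 1 / N * \<phi> k x) = 1"
    using N q_gt by (subst Lq_norm_cmult) (auto simp: N_def)
  ultimately show ?thesis
    using test_funs_mult_const[OF \<phi>(1)] by (intro that[of "\<lambda>x. 1 / N * \<phi> k x"])
qed

lemma nonneg_eigenfunction_le_Lambda:
  assumes v: "eigenfunction lam v" and "neg_mass v = 0"
  shows "lam \<le> Lambda_q s q \<Omega>"
proof -
  have [measurable]: "v \<in> borel_measurable lebesgue"
    by (rule eigenfunction_measurable[OF v])
  have "AE x in lebesgue. ennreal (max 0 (- v x)) = 0"
    using assms(2) unfolding neg_mass_def by (subst (asm) nn_integral_0_iff_AE) auto
  then have nonneg: "AE x in lebesgue. 0 \<le> v x"
    by eventually_elim (auto simp: ennreal_eq_0_iff)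
  let ?I = "INF \<phi>\<in>{\<phi>\<in>test_funs \<Omega>. Lq_norm q \<Omega> \<phi> = 1}. gagliardo_sq s \<phi>"
  have "ennreal lam \<le> ?I"
  proof (rule INF_greatest)
    fix \<phi> assume "\<phi> \<in> {\<phi>\<in>test_funs \<Omega>. Lq_norm q \<Omega> \<phi> = 1}"
    then show "ennreal lam \<le> gagliardo_sq s \<phi>"
      using nonneg_eigenfunction_le_gagliardo[OF v nonneg, of \<phi>]
      by (cases "gagliardo_sq s \<phi> < \<infinity>") (auto simp: not_less top_unique)
  qed
  moreover obtain \<psi> where \<psi>: "\<psi> \<in> test_funs \<Omega>" "Lq_norm q \<Omega> \<psi> = 1" "gagliardo_sq s \<psi> < \<infinity>"
    by (rule ex_test_fun_finite[OF v])
  have "?I \<le> gagliardo_sq s \<psi>"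
    by (rule INF_lower) (use \<psi> in auto)
  \<comment> \<open>A finite infimum is required because \<open>Lambda_q\<close> is its
    \<open>enn2real\<close>, which would be 0 for \<infinity>.\<close>
  with \<psi>(3) have "?I < \<infinity>" by (rule le_less_trans[rotated])
  ultimately have "ennreal lam \<le> ennreal (Lambda_q s q \<Omega>)"
    by (simp add: Lambda_q_def)
  then show ?thesis
    by (subst (asm) ennreal_le_iff) (auto simp: Lambda_q_nonneg)
qed

text \<open>The sum of the masses is bounded below, while the gap bounds their product by a multiple
  of lam - \<Lambda>. One of them therefore drops under the threshold at which it must vanish, and a
  solution of one sign has lam <= \<Lambda>. The uniform constants give one \<open>\<delta>\<close>
  for all solutions.\<close>

lemma Lambda_q_isolated:
  obtains \<delta> where "0 < \<delta>"
    "\<And>lam v. eigenfunction lam v \<Longrightarrow> lam < Lambda_q s q \<Omega> + \<delta> \<Longrightarrow> lam = Lambda_q s q \<Omega>"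
proof -
  define L where "L = Lambda_q s q \<Omega> + 1"
  have L: "0 < L"
    using Lambda_q_nonneg[of s q \<Omega>] by (simp add: L_def)
  obtain c where c: "0 < c" "\<And>lam v. eigenfunction lam v \<Longrightarrow> lam \<le> L \<Longrightarrow> ennreal c \<le> pos_mass v + neg_mass v"
    using eigenfunction_mass_ge[OF L] by blast
  obtain \<eta> where \<eta>: "0 < \<eta>" "\<And>lam v. eigenfunction lam v \<Longrightarrow> lam \<le> L \<Longrightarrow>
    ennreal (kappa * (c / 2)) \<le> ennreal kappa * pos_mass v \<Longrightarrow> neg_mass v \<le> ennreal \<eta> \<Longrightarrow> neg_mass v = 0"
    using eigenfunction_neg_mass_eq_0[of "kappa * (c / 2)" L] kappa_pos c(1) L by auto
  \<comment> \<open>The 1 keeps \<open>lam\<close> below \<open>L\<close>. When one mass is at least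
    c / 2, the other entry pushes the remaining mass below \<eta>.\<close>
  define \<delta> where "\<delta> = min 1 (kappa * (c / 2) * \<eta>)"
  have main: "lam \<le> Lambda_q s q \<Omega>" if v: "eigenfunction lam v" and lam: "lam < Lambda_q s q \<Omega> + \<delta>"
    and P: "ennreal (c / 2) \<le> pos_mass v" for lam v
  proof -
    have "pos_mass v + neg_mass v < \<infinity>"
      using eigenfunction_L1_finite[OF v] mass_add[OF eigenfunction_measurable[OF v]] by simp
    then obtain a b where ab: "pos_mass v = ennreal a" "0 \<le> a" "neg_mass v = ennreal b" "0 \<le> b"
      by (cases "pos_mass v"; cases "neg_mass v") auto
    have a: "c / 2 \<le> a"
      using P ab by simp
    have "ennreal (Lambda_q s q \<Omega> + kappa * (a * b)) \<le> ennreal lam"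
      using eigenfunction_gap[OF v] ab kappa_pos Lambda_q_nonneg[of s q \<Omega>] by (simp add: ennreal_mult)
    moreover have "0 < lam" using v by (simp add: eigenfunction_def)
    ultimately have "kappa * (a * b) < kappa * (c / 2) * \<eta>"
      using lam by (simp add: \<delta>_def)
    moreover have "kappa * (c / 2) * b \<le> kappa * (a * b)"
      using mult_left_mono[OF mult_right_mono[OF a ab(4)] less_imp_le[OF kappa_pos]]
      by (simp only: mult.assoc)
    ultimately have "kappa * (c / 2) * b < kappa * (c / 2) * \<eta>" by linarith
    then have "b < \<eta>"
      using kappa_pos c(1) by (subst (asm) mult_less_cancel_left_pos) auto
    moreover have "lam \<le> L"
      using lam by (simp add: L_def \<delta>_def)
    moreover have "ennreal (kappa * (c / 2)) \<le> ennreal kappa * pos_mass v"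
      using a ab kappa_pos by (simp add: ennreal_mult[symmetric] ennreal_leI)
    ultimately have "neg_mass v = 0"
      using \<eta>(2)[OF v] ab by (simp add: ennreal_leI)
    then show ?thesis
      by (rule nonneg_eigenfunction_le_Lambda[OF v])
  qed
  show ?thesis
  proof (rule that)
    show "0 < \<delta>" using kappa_pos c(1) \<eta>(1) by (simp add: \<delta>_def)
    fix lam v assume v: "eigenfunction lam v" and lam: "lam < Lambda_q s q \<Omega> + \<delta>"
    have "lam \<le> Lambda_q s q \<Omega>"
    proof (cases "ennreal (c / 2) \<le> pos_mass v")
      case True
      then show ?thesis by (rule main[OF v lam])
    next
      case False
      have "ennreal c \<le> pos_mass v + neg_mass v"
        using c(2)[OF v] lam by (simp add: L_def \<delta>_def)
      \<comment> \<open>A positive mass below c / 2 leaves at least c / 2 for the negative mass, and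
        the argument applies to -v.\<close>
      with False have "ennreal (c / 2) \<le> neg_mass v"
        using c(1) by (cases "pos_mass v"; cases "neg_mass v") (auto simp: ennreal_plus[symmetric] simp del: ennreal_plus)
      then show ?thesis
        using main[OF eigenfunction_uminus[OF v] lam] by (simp add: pos_mass_uminus)
    qed
    moreover have "ennreal (Lambda_q s q \<Omega>) \<le> ennreal lam"
      by (rule order_trans[OF _ eigenfunction_gap[OF v]]) auto
    then have "Lambda_q s q \<Omega> \<le> lam"
      using v by (subst (asm) ennreal_le_iff) (auto simp: eigenfunction_def)
    ultimately show "lam = Lambda_q s q \<Omega>" by simp
  qed
qed

end

theorem theorem1p1:
  fixes s q :: real and \<Omega> :: "'a::euclidean_space set"
  assumes "0 < s" "s < 1" "1 < q" "q < 2"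
    and "bounded \<Omega>" "open \<Omega>"
    and "wiener_regular s \<Omega>"
  shows "\<not> (\<exists>(lam::nat \<Rightarrow> real) (v::nat \<Rightarrow> 'a \<Rightarrow> real).
            (\<forall>i. 0 < lam i \<and> lam i \<noteq> Lambda_q s q \<Omega> \<and>
                 v i \<in> D_s2_0 s \<Omega> \<and> Lq_norm q \<Omega> (v i) = 1 \<and>
                 weak_solution s \<Omega>
                   (\<lambda>\<phi>. \<integral>x\<in>\<Omega>. lam i * \<bar>v i x\<bar> powr (q - 2) * v i x * \<phi> x \<partial>lebesgue)
                   (\<lambda>_. 0) (v i)) \<and>
            lam \<longlonglongrightarrow> Lambda_q s q \<Omega>)"
proof
  interpret sublinear_domain s q \<Omega>
    using assms by unfold_locales
  assume "\<exists>(lam::nat \<Rightarrow> real) (v::nat \<Rightarrow> 'a \<Rightarrow> real).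
            (\<forall>i. 0 < lam i \<and> lam i \<noteq> Lambda_q s q \<Omega> \<and>
                 v i \<in> D_s2_0 s \<Omega> \<and> Lq_norm q \<Omega> (v i) = 1 \<and>
                 weak_solution s \<Omega>
                   (\<lambda>\<phi>. \<integral>x\<in>\<Omega>. lam i * \<bar>v i x\<bar> powr (q - 2) * v i x * \<phi> x \<partial>lebesgue)
                   (\<lambda>_. 0) (v i)) \<and>
            lam \<longlonglongrightarrow> Lambda_q s q \<Omega>"
  then obtain lam v where lam: "\<And>i. lam i \<noteq> Lambda_q s q \<Omega>" "lam \<longlonglongrightarrow> Lambda_q s q \<Omega>"
    and v: "\<And>i. eigenfunction (lam i) (v i)"
    unfolding eigenfunction_def by blast
  obtain \<delta> where \<delta>: "0 < \<delta>"
    "\<And>lam v. eigenfunction lam v \<Longrightarrow> lam < Lambda_q s q \<Omega> + \<delta> \<Longrightarrow> lam = Lambda_q s q \<Omega>"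
    using Lambda_q_isolated by blast
  have "eventually (\<lambda>i. lam i < Lambda_q s q \<Omega> + \<delta>) sequentially"
    using lam(2) \<delta>(1) by (intro order_tendstoD) auto
  then obtain i where "lam i < Lambda_q s q \<Omega> + \<delta>"
    by (auto simp: eventually_sequentially)
  from \<delta>(2)[OF v this] lam(1) show False
    by blast
qed

end
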